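(* Let $k$ be a commutative ring, $G$ a finite group and $A$ a $G$-graded $k$-algebra. Let $\mathcal{B}_A$ be the single object category over $k$ with endomorphism $k$-algebra $A$. Then the category $\mathcal{B}_A$ is $G$-graded (by the grading of $A$), and the $k$-algebra $a(\mathcal{B}_A\# G)$ of the smash product category $\mathcal{B}_A\# G$ is isomorphic to the smash product algebra $A\# G$.
   Context: Category over $k$: a small category with object set $\mathcal{B}_0$ such that each morphism set ${}_y\mathcal{B}_x$ (morphisms from $x$ to $y$) is a $k$-module and composition is $k$-bilinear. $G$-graded category over $k$: a category $\mathcal{B}$ over $k$ with decompositions ${}_y\mathcal{B}_x=\bigoplus_{s\in G}{}_y\mathcal{B}_x^{\,s}$ such that ${}_z\mathcal{B}_y^{\,t}\;{}_y\mathcal{B}_x^{\,s}\subset{}_z\mathcal{B}_x^{\,ts}$ and ${}_x1_x\in{}_x\mathcal{B}_x^{\,1}$. $G$-graded $k$-algebra: $A=\bigoplus_{s\in G}A_s$ with $A_tA_s\subset A_{ts}$ and $1\in A_1$. Smash product category $\mathcal{B}\# G$: objects $\mathcal{B}_0\times G$, morphisms ${}_{(y,t)}(\mathcal{B}\# G)_{(x,s)}={}_y\mathcal{B}_x^{\,t^{-1}s}$, composition given by the composition ${}_z\mathcal{B}_y^{\,u^{-1}t}\otimes_k{}_y\mathcal{B}_x^{\,t^{-1}s}\to{}_z\mathcal{B}_x^{\,u^{-1}s}$ of $\mathcal{B}$. For a category $\mathcal{D}$ over $k$ with finitely many objects, $a(\mathcal{D})=\bigoplus_{x,y\in\mathcal{D}_0}{}_y\mathcal{D}_x$,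 with product of $g\in{}_z\mathcal{D}_{y'}$ and $f\in{}_y\mathcal{D}_x$ equal to $gf$ if $y=y'$ and $0$ otherwise. Smash product algebra $A\# G$ (also written $A\# k^G$), for $G$ finite: the $k$-module $A\otimes_k k^G$, where $k^G$ is the algebra of maps $G\to k$ with basis the Dirac masses $\delta_s$ ($s\in G$), with the product for which $A$ and $k^G$ are subalgebras, $a\otimes\delta=a\delta$, and $\delta_t f_s=f_s\,\delta_{s^{-1}t}$ for $t\in G$ and $f_s\in A_s$; that is, $(a\otimes\delta_t)(f_s\otimes\delta_u)=af_s\otimes\delta_{s^{-1}t}\delta_u$. *)

theory Defs
  imports "HOL.Hull" "HOL-Algebra.Module" "HOL-Algebra.QuotRing"
begin

section \<open>Modules and algebras over a commutative ring\<close>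

text \<open>The library locale \<^locale>\<open>algebra\<close> asks for a commutative algebra; here the algebra
  is associative and unital but need not be commutative.\<close>

locale k_algebra = module + ring M +
  assumes smult_mult_l:
      "\<lbrakk> a \<in> carrier R; x \<in> carrier M; y \<in> carrier M \<rbrakk> \<Longrightarrow>
      (a \<odot>\<^bsub>M\<^esub> x) \<otimes>\<^bsub>M\<^esub> y = a \<odot>\<^bsub>M\<^esub> (x \<otimes>\<^bsub>M\<^esub> y)"
    and smult_mult_r:
      "\<lbrakk> a \<in> carrier R; x \<in> carrier M; y \<in> carrier M \<rbrakk> \<Longrightarrow>
      x \<otimes>\<^bsub>M\<^esub> (a \<odot>\<^bsub>M\<^esub> y) = a \<odot>\<^bsub>M\<^esub> (x \<otimes>\<^bsub>M\<^esub> y)"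

definition k_algebra_iso ::
    "('k, 'r) ring_scheme \<Rightarrow> ('k, 'a, 'p) module_scheme \<Rightarrow> ('k, 'b, 'q) module_scheme \<Rightarrow> ('a \<Rightarrow> 'b) set"
  where "k_algebra_iso k A B =
    {h \<in> ring_iso A B. \<forall>c \<in> carrier k. \<forall>a \<in> carrier A. h (c \<odot>\<^bsub>A\<^esub> a) = c \<odot>\<^bsub>B\<^esub> h a}"

definition bilinear ::
    "('k, 'r) ring_scheme \<Rightarrow> ('k, 'a, 'p) module_scheme \<Rightarrow> ('k, 'b, 'q) module_scheme
      \<Rightarrow> ('k, 'c, 's) module_scheme \<Rightarrow> ('a \<Rightarrow> 'b \<Rightarrow> 'c) \<Rightarrow> bool"
  where "bilinear k M N P f \<longleftrightarrow>
    (\<forall>m \<in> carrier M. \<forall>n \<in> carrier N. f m n \<in> carrier P) \<and>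
    (\<forall>m \<in> carrier M. \<forall>m' \<in> carrier M. \<forall>n \<in> carrier N.
       f (m \<oplus>\<^bsub>M\<^esub> m') n = f m n \<oplus>\<^bsub>P\<^esub> f m' n) \<and>
    (\<forall>m \<in> carrier M. \<forall>n \<in> carrier N. \<forall>n' \<in> carrier N.
       f m (n \<oplus>\<^bsub>N\<^esub> n') = f m n \<oplus>\<^bsub>P\<^esub> f m n') \<and>
    (\<forall>c \<in> carrier k. \<forall>m \<in> carrier M. \<forall>n \<in> carrier N.
       f (c \<odot>\<^bsub>M\<^esub> m) n = c \<odot>\<^bsub>P\<^esub> f m n \<and> f m (c \<odot>\<^bsub>N\<^esub> n) = c \<odot>\<^bsub>P\<^esub> f m n)"

text \<open>Internal direct sum of a family of submodules: every element is, in a unique way, a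
  finitely supported sum of components.  The index set may be infinite.\<close>

definition direct_sum_decomposition ::
    "('k, 'r) ring_scheme \<Rightarrow> ('k, 'a, 'p) module_scheme \<Rightarrow> 'i set \<Rightarrow> ('i \<Rightarrow> 'a set) \<Rightarrow> bool"
  where "direct_sum_decomposition k M I N \<longleftrightarrow>
    (\<forall>i \<in> I. submodule (N i) k M) \<and>
    (\<forall>m \<in> carrier M. \<exists>!c. c \<in> (\<Pi>\<^sub>E i \<in> I. N i) \<and> finite {i \<in> I. c i \<noteq> \<zero>\<^bsub>M\<^esub>} \<and>
       m = (\<Oplus>\<^bsub>M\<^esub> i \<in> {i \<in> I. c i \<noteq> \<zero>\<^bsub>M\<^esub>}. c i))"

locale graded_algebra = k_algebra k A + group G
  for k :: "('k, 'r) ring_scheme" and G :: "('g, 's) monoid_scheme"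
    and A :: "('k, 'a, 'p) module_scheme" and gr :: "'g \<Rightarrow> 'a set" +
  assumes decomposition: "direct_sum_decomposition k A (carrier G) gr"
    and mult_homogeneous: "\<lbrakk> t \<in> carrier G; s \<in> carrier G; a \<in> gr t; b \<in> gr s \<rbrakk> \<Longrightarrow>
      a \<otimes>\<^bsub>A\<^esub> b \<in> gr (t \<otimes>\<^bsub>G\<^esub> s)"
    and one_homogeneous: "\<one>\<^bsub>A\<^esub> \<in> gr \<one>\<^bsub>G\<^esub>"


section \<open>Categories over a commutative ring\<close>

text \<open>Targets come before sources: \<open>Hom C y x\<close> is the module of morphisms from \<open>x\<close> to \<open>y\<close>,
  and \<open>Comp C z y x g f\<close> is the composite of \<open>f\<close> from \<open>x\<close> to \<open>y\<close> and \<open>g\<close> from \<open>y\<close> to \<open>z\<close>.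
  Only the \<open>k\<close>-module structure of \<open>Hom C y x\<close> matters; the ring operations that the
  record type \<^type>\<open>module\<close> also carries are ignored.\<close>

record ('o, 'k, 'm) k_category =
  Obj :: "'o set"
  Hom :: "'o \<Rightarrow> 'o \<Rightarrow> ('k, 'm) module"
  Comp :: "'o \<Rightarrow> 'o \<Rightarrow> 'o \<Rightarrow> 'm \<Rightarrow> 'm \<Rightarrow> 'm"
  Ident :: "'o \<Rightarrow> 'm"

locale category_over = cring k
  for k :: "('k, 'r) ring_scheme" and C :: "('o, 'k, 'm) k_category" +
  assumes hom_module: "\<lbrakk> x \<in> Obj C; y \<in> Obj C \<rbrakk> \<Longrightarrow> module k (Hom C y x)"
    and comp_bilinear: "\<lbrakk> x \<in> Obj C; y \<in> Obj C; z \<in> Obj C \<rbrakk> \<Longrightarrow>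
      bilinear k (Hom C z y) (Hom C y x) (Hom C z x) (Comp C z y x)"
    and comp_assoc: "\<lbrakk> x \<in> Obj C; y \<in> Obj C; z \<in> Obj C; w \<in> Obj C;
        f \<in> carrier (Hom C y x); g \<in> carrier (Hom C z y); h \<in> carrier (Hom C w z) \<rbrakk> \<Longrightarrow>
      Comp C w y x (Comp C w z y h g) f = Comp C w z x h (Comp C z y x g f)"
    and ident_closed: "x \<in> Obj C \<Longrightarrow> Ident C x \<in> carrier (Hom C x x)"
    and ident_left: "\<lbrakk> x \<in> Obj C; y \<in> Obj C; f \<in> carrier (Hom C y x) \<rbrakk> \<Longrightarrow>
      Comp C y y x (Ident C y) f = f"
    and ident_right: "\<lbrakk> x \<in> Obj C; y \<in> Obj C; f \<in> carrier (Hom C y x) \<rbrakk> \<Longrightarrow>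
      Comp C y x x f (Ident C x) = f"

locale graded_category = category_over k B + group G
  for k :: "('k, 'r) ring_scheme" and G :: "('g, 's) monoid_scheme"
    and B :: "('o, 'k, 'm) k_category" and gr :: "'o \<Rightarrow> 'o \<Rightarrow> 'g \<Rightarrow> 'm set" +
  assumes hom_decomposition: "\<lbrakk> x \<in> Obj B; y \<in> Obj B \<rbrakk> \<Longrightarrow>
      direct_sum_decomposition k (Hom B y x) (carrier G) (gr y x)"
    and comp_homogeneous: "\<lbrakk> x \<in> Obj B; y \<in> Obj B; z \<in> Obj B; t \<in> carrier G; s \<in> carrier G;
        g \<in> gr z y t; f \<in> gr y x s \<rbrakk> \<Longrightarrow> Comp B z y x g f \<in> gr z x (t \<otimes>\<^bsub>G\<^esub> s)"
    and ident_homogeneous: "x \<in> Obj B \<Longrightarrow> Ident B x \<in> gr x x \<one>\<^bsub>G\<^esub>"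

definition single_object_category :: "('k, 'a) module \<Rightarrow> (unit, 'k, 'a) k_category"
  where "single_object_category A =
    \<lparr>Obj = {()}, Hom = (\<lambda>_ _. A), Comp = (\<lambda>_ _ _. mult A), Ident = (\<lambda>_. \<one>\<^bsub>A\<^esub>)\<rparr>"

definition smash_category ::
    "('g, 's) monoid_scheme \<Rightarrow> ('o, 'k, 'm) k_category \<Rightarrow> ('o \<Rightarrow> 'o \<Rightarrow> 'g \<Rightarrow> 'm set)
      \<Rightarrow> ('o \<times> 'g, 'k, 'm) k_category"
  where "smash_category G B gr =
    \<lparr>Obj = Obj B \<times> carrier G,
     Hom = (\<lambda>(y, t) (x, s). (Hom B y x)\<lparr>carrier := gr y x (inv\<^bsub>G\<^esub> t \<otimes>\<^bsub>G\<^esub> s)\<rparr>),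
     Comp = (\<lambda>(z, u) (y, t) (x, s). Comp B z y x),
     Ident = (\<lambda>(x, s). Ident B x)\<rparr>"

text \<open>The algebra \<open>a(D)\<close> of a category with finitely many objects.  An element of the direct sum
  of all morphism modules is a family \<open>f\<close> with \<open>f (y, x)\<close> in \<open>Hom D y x\<close>, and the
  product is the bilinear extension of composition of composable pairs (zero on
  non-composable ones), that is, a matrix product; see \<open>mult_hom_inclusion\<close> below.\<close>

definition category_algebra :: "('o, 'k, 'm) k_category \<Rightarrow> ('k, 'o \<times> 'o \<Rightarrow> 'm) module"
  where "category_algebra D =
    \<lparr>carrier = (\<Pi>\<^sub>E (y, x) \<in> Obj D \<times> Obj D. carrier (Hom D y x)),
     mult = (\<lambda>g f. \<lambda>(z, x) \<in> Obj D \<times> Obj D.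
       \<Oplus>\<^bsub>Hom D z x\<^esub> y \<in> Obj D. Comp D z y x (g (z, y)) (f (y, x))),
     one = (\<lambda>(y, x) \<in> Obj D \<times> Obj D. if y = x then Ident D x else \<zero>\<^bsub>Hom D y x\<^esub>),
     zero = (\<lambda>(y, x) \<in> Obj D \<times> Obj D. \<zero>\<^bsub>Hom D y x\<^esub>),
     add = (\<lambda>f g. \<lambda>(y, x) \<in> Obj D \<times> Obj D. f (y, x) \<oplus>\<^bsub>Hom D y x\<^esub> g (y, x)),
     smult = (\<lambda>c f. \<lambda>(y, x) \<in> Obj D \<times> Obj D. c \<odot>\<^bsub>Hom D y x\<^esub> f (y, x))\<rparr>"

definition hom_inclusion :: "('o, 'k, 'm) k_category \<Rightarrow> 'o \<Rightarrow> 'o \<Rightarrow> 'm \<Rightarrow> ('o \<times> 'o \<Rightarrow> 'm)"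
  where "hom_inclusion D y x f =
    (\<lambda>(y', x') \<in> Obj D \<times> Obj D. if y' = y \<and> x' = x then f else \<zero>\<^bsub>Hom D y' x'\<^esub>)"

lemma bilinear_zero:
  assumes M: "module k M" and N: "module k N" and P: "module k P" and f: "bilinear k M N P f"
  shows "n \<in> carrier N \<Longrightarrow> f \<zero>\<^bsub>M\<^esub> n = \<zero>\<^bsub>P\<^esub>"
    and "m \<in> carrier M \<Longrightarrow> f m \<zero>\<^bsub>N\<^esub> = \<zero>\<^bsub>P\<^esub>"
proof -
  interpret M: module k M by fact
  interpret N: module k N by fact
  interpret P: module k P by fact
  { assume n: "n \<in> carrier N"
    have "f (\<zero>\<^bsub>k\<^esub> \<odot>\<^bsub>M\<^esub> \<zero>\<^bsub>M\<^esub>) n = \<zero>\<^bsub>k\<^esub> \<odot>\<^bsub>P\<^esub> f \<zero>\<^bsub>M\<^esub> n" and "f \<zero>\<^bsub>M\<^esub> n \<in> carrier P"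
      using f n M.M.zero_closed M.R.zero_closed unfolding bilinear_def by blast+
    then show "f \<zero>\<^bsub>M\<^esub> n = \<zero>\<^bsub>P\<^esub>" by simp }
  { assume m: "m \<in> carrier M"
    have "f m (\<zero>\<^bsub>k\<^esub> \<odot>\<^bsub>N\<^esub> \<zero>\<^bsub>N\<^esub>) = \<zero>\<^bsub>k\<^esub> \<odot>\<^bsub>P\<^esub> f m \<zero>\<^bsub>N\<^esub>" and "f m \<zero>\<^bsub>N\<^esub> \<in> carrier P"
      using f m N.M.zero_closed M.R.zero_closed unfolding bilinear_def by blast+
    then show "f m \<zero>\<^bsub>N\<^esub> = \<zero>\<^bsub>P\<^esub>" by simp }
qed

lemma (in category_over) mult_hom_inclusion:
  assumes fin: "finite (Obj C)"
    and ob: "x \<in> Obj C" "y \<in> Obj C" "y' \<in> Obj C" "z \<in> Obj C"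
    and g: "g \<in> carrier (Hom C z y')" and f: "f \<in> carrier (Hom C y x)"
  shows "hom_inclusion C z y' g \<otimes>\<^bsub>category_algebra C\<^esub> hom_inclusion C y x f =
    (if y' = y then hom_inclusion C z x (Comp C z y x g f) else \<zero>\<^bsub>category_algebra C\<^esub>)"
proof -
  have entry: "(\<Oplus>\<^bsub>Hom C w v\<^esub> u \<in> Obj C.
        Comp C w u v (hom_inclusion C z y' g (w, u)) (hom_inclusion C y x f (u, v))) =
      (if y' = y \<and> w = z \<and> v = x then Comp C z y x g f else \<zero>\<^bsub>Hom C w v\<^esub>)"
    if w: "w \<in> Obj C" and v: "v \<in> Obj C" for w v
  proof -
    interpret H: module k "Hom C w v" using hom_module w v by blast
    define c where "c = (if y' = y \<and> w = z \<and> v = x then Comp C z y x g f else \<zero>\<^bsub>Hom C w v\<^esub>)"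
    have c: "c \<in> carrier (Hom C w v)"
      using comp_bilinear[of x y z] ob f g unfolding bilinear_def c_def by auto
    have summand: "Comp C w u v (hom_inclusion C z y' g (w, u)) (hom_inclusion C y x f (u, v)) =
        (if y = u then c else \<zero>\<^bsub>Hom C w v\<^esub>)" if u: "u \<in> Obj C" for u
    proof -
      have wu: "module k (Hom C w u)" and uv: "module k (Hom C u v)"
        using hom_module w u v by blast+
      note z = bilinear_zero[OF wu uv H.module_axioms comp_bilinear[OF v u w]]
      interpret wu: module k "Hom C w u" by fact
      interpret uv: module k "Hom C u v" by fact
      show ?thesis using w u v f g z by (auto simp: hom_inclusion_def c_def)
    qed
    have "(\<Oplus>\<^bsub>Hom C w v\<^esub> u \<in> Obj C.
        Comp C w u v (hom_inclusion C z y' g (w, u)) (hom_inclusion C y x f (u, v))) =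
      (\<Oplus>\<^bsub>Hom C w v\<^esub> u \<in> Obj C. if y = u then c else \<zero>\<^bsub>Hom C w v\<^esub>)"
      using c by (intro H.M.finsum_cong') (auto simp: summand)
    also have "\<dots> = c"
      using H.M.add.finprod_singleton[OF ob(2) fin, of "\<lambda>_. c"] c by (simp add: finsum_def)
    finally show ?thesis unfolding c_def .
  qed
  show ?thesis
  proof (rule ext)
    fix p :: "'o \<times> 'o"
    obtain w v where p: "p = (w, v)" by fastforce
    show "(hom_inclusion C z y' g \<otimes>\<^bsub>category_algebra C\<^esub> hom_inclusion C y x f) p =
      (if y' = y then hom_inclusion C z x (Comp C z y x g f) else \<zero>\<^bsub>category_algebra C\<^esub>) p"
    proof (cases "w \<in> Obj C \<and> v \<in> Obj C")
      case True
      then have "(hom_inclusion C z y' g \<otimes>\<^bsub>category_algebra C\<^esub> hom_inclusion C y x f) p =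
        (if y' = y \<and> w = z \<and> v = x then Comp C z y x g f else \<zero>\<^bsub>Hom C w v\<^esub>)"
        using entry[of w v] by (simp add: category_algebra_def p)
      also have "\<dots> = (if y' = y then hom_inclusion C z x (Comp C z y x g f)
          else \<zero>\<^bsub>category_algebra C\<^esub>) p"
        using True by (simp add: category_algebra_def hom_inclusion_def p)
      finally show ?thesis .
    next
      case False
      then show ?thesis
        by (auto simp: category_algebra_def hom_inclusion_def p)
    qed
  qed
qed


section \<open>Tensor products\<close>

definition dirac :: "('k, 'r) ring_scheme \<Rightarrow> 'x set \<Rightarrow> 'x \<Rightarrow> ('x \<Rightarrow> 'k)"
  where "dirac k X x = (\<lambda>y \<in> X. if y = x then \<one>\<^bsub>k\<^esub> else \<zero>\<^bsub>k\<^esub>)"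

text \<open>\<^type>\<open>module\<close> extends the type of rings, so modules without a product leave
  \<^const>\<open>mult\<close> and \<^const>\<open>one\<close> unspecified.\<close>

definition free_module :: "('k, 'r) ring_scheme \<Rightarrow> 'x set \<Rightarrow> ('k, 'x \<Rightarrow> 'k) module"
  where "free_module k X =
    \<lparr>carrier = {p \<in> X \<rightarrow>\<^sub>E carrier k. finite {x \<in> X. p x \<noteq> \<zero>\<^bsub>k\<^esub>}},
     mult = undefined, one = undefined,
     zero = (\<lambda>x \<in> X. \<zero>\<^bsub>k\<^esub>),
     add = (\<lambda>p q. \<lambda>x \<in> X. p x \<oplus>\<^bsub>k\<^esub> q x),
     smult = (\<lambda>c p. \<lambda>x \<in> X. c \<otimes>\<^bsub>k\<^esub> p x)\<rparr>"

definition quotient_module :: "('k, 'a, 'p) module_scheme \<Rightarrow> 'a set \<Rightarrow> ('k, 'a set) module"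
  where "quotient_module M N =
    \<lparr>carrier = a_rcosets\<^bsub>M\<^esub> N,
     mult = undefined, one = undefined,
     zero = N,
     add = set_add M,
     smult = (\<lambda>c X. \<Union>x \<in> X. N +>\<^bsub>M\<^esub> (c \<odot>\<^bsub>M\<^esub> x))\<rparr>"

definition tensor_relations ::
    "('k, 'r) ring_scheme \<Rightarrow> ('k, 'a, 'p) module_scheme \<Rightarrow> ('k, 'b, 'q) module_scheme
      \<Rightarrow> ('a \<times> 'b \<Rightarrow> 'k) set"
  where "tensor_relations k M N =
    (let F = free_module k (carrier M \<times> carrier N);
         e = (\<lambda>m n. dirac k (carrier M \<times> carrier N) (m, n))
     in {e (m \<oplus>\<^bsub>M\<^esub> m') n \<ominus>\<^bsub>F\<^esub> (e m n \<oplus>\<^bsub>F\<^esub> e m' n) | m m' n.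
           m \<in> carrier M \<and> m' \<in> carrier M \<and> n \<in> carrier N}
      \<union> {e m (n \<oplus>\<^bsub>N\<^esub> n') \<ominus>\<^bsub>F\<^esub> (e m n \<oplus>\<^bsub>F\<^esub> e m n') | m n n'.
           m \<in> carrier M \<and> n \<in> carrier N \<and> n' \<in> carrier N}
      \<union> {e (c \<odot>\<^bsub>M\<^esub> m) n \<ominus>\<^bsub>F\<^esub> (c \<odot>\<^bsub>F\<^esub> e m n) | c m n.
           c \<in> carrier k \<and> m \<in> carrier M \<and> n \<in> carrier N}
      \<union> {e m (c \<odot>\<^bsub>N\<^esub> n) \<ominus>\<^bsub>F\<^esub> (c \<odot>\<^bsub>F\<^esub> e m n) | c m n.
           c \<in> carrier k \<and> m \<in> carrier M \<and> n \<in> carrier N})"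

definition tensor_kernel ::
    "('k, 'r) ring_scheme \<Rightarrow> ('k, 'a, 'p) module_scheme \<Rightarrow> ('k, 'b, 'q) module_scheme
      \<Rightarrow> ('a \<times> 'b \<Rightarrow> 'k) set"
  where "tensor_kernel k M N =
    (\<lambda>H. submodule H k (free_module k (carrier M \<times> carrier N))) hull tensor_relations k M N"

definition tensor_product ::
    "('k, 'r) ring_scheme \<Rightarrow> ('k, 'a, 'p) module_scheme \<Rightarrow> ('k, 'b, 'q) module_scheme
      \<Rightarrow> ('k, ('a \<times> 'b \<Rightarrow> 'k) set) module"
  where "tensor_product k M N =
    quotient_module (free_module k (carrier M \<times> carrier N)) (tensor_kernel k M N)"

definition tensor ::
    "('k, 'r) ring_scheme \<Rightarrow> ('k, 'a, 'p) module_scheme \<Rightarrow> ('k, 'b, 'q) module_scheme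
      \<Rightarrow> 'a \<Rightarrow> 'b \<Rightarrow> ('a \<times> 'b \<Rightarrow> 'k) set"
  where "tensor k M N m n =
    tensor_kernel k M N +>\<^bsub>free_module k (carrier M \<times> carrier N)\<^esub>
      dirac k (carrier M \<times> carrier N) (m, n)"


section \<open>The smash product algebra\<close>

definition function_algebra :: "('k, 'r) ring_scheme \<Rightarrow> 'g set \<Rightarrow> ('k, 'g \<Rightarrow> 'k) module"
  where "function_algebra k X =
    \<lparr>carrier = X \<rightarrow>\<^sub>E carrier k,
     mult = (\<lambda>p q. \<lambda>x \<in> X. p x \<otimes>\<^bsub>k\<^esub> q x),
     one = (\<lambda>x \<in> X. \<one>\<^bsub>k\<^esub>),
     zero = (\<lambda>x \<in> X. \<zero>\<^bsub>k\<^esub>),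
     add = (\<lambda>p q. \<lambda>x \<in> X. p x \<oplus>\<^bsub>k\<^esub> q x),
     smult = (\<lambda>c p. \<lambda>x \<in> X. c \<otimes>\<^bsub>k\<^esub> p x)\<rparr>"

text \<open>\<open>is_smash_product_mult k G A gr \<mu>\<close> says that \<open>\<mu>\<close> is a \<open>k\<close>-bilinear product on the
  tensor product of \<open>A\<close> and the function algebra of \<open>G\<close>, satisfying the commutation rule
  between Dirac masses and homogeneous elements.  The first clause fixes
  \<open>\<mu>\<close> off the carrier, so that there is only one such function.\<close>

definition is_smash_product_mult ::
    "('k, 'r) ring_scheme \<Rightarrow> ('g, 's) monoid_scheme \<Rightarrow> ('k, 'a, 'p) module_scheme
      \<Rightarrow> ('g \<Rightarrow> 'a set)
      \<Rightarrow> (('a \<times> ('g \<Rightarrow> 'k) \<Rightarrow> 'k) set \<Rightarrow> ('a \<times> ('g \<Rightarrow> 'k) \<Rightarrow> 'k) set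
            \<Rightarrow> ('a \<times> ('g \<Rightarrow> 'k) \<Rightarrow> 'k) set) \<Rightarrow> bool"
  where "is_smash_product_mult k G A gr \<mu> \<longleftrightarrow>
    (let kG = function_algebra k (carrier G);
         T = tensor_product k A kG;
         tens = tensor k A kG;
         \<delta> = dirac k (carrier G)
     in (\<forall>X Y. X \<notin> carrier T \<or> Y \<notin> carrier T \<longrightarrow> \<mu> X Y = undefined) \<and>
        bilinear k T T T \<mu> \<and>
        (\<forall>a \<in> carrier A. \<forall>s \<in> carrier G. \<forall>f \<in> gr s. \<forall>t \<in> carrier G. \<forall>u \<in> carrier G.
           \<mu> (tens a (\<delta> t)) (tens f (\<delta> u)) =
             tens (a \<otimes>\<^bsub>A\<^esub> f) (\<delta> (inv\<^bsub>G\<^esub> s \<otimes>\<^bsub>G\<^esub> t) \<otimes>\<^bsub>kG\<^esub> \<delta> u)))"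

definition smash_algebra ::
    "('k, 'r) ring_scheme \<Rightarrow> ('g, 's) monoid_scheme \<Rightarrow> ('k, 'a, 'p) module_scheme
      \<Rightarrow> ('g \<Rightarrow> 'a set) \<Rightarrow> ('k, ('a \<times> ('g \<Rightarrow> 'k) \<Rightarrow> 'k) set) module"
  where "smash_algebra k G A gr =
    (let kG = function_algebra k (carrier G)
     in (tensor_product k A kG)
          \<lparr>mult := (THE \<mu>. is_smash_product_mult k G A gr \<mu>),
           one := tensor k A kG \<one>\<^bsub>A\<^esub> \<one>\<^bsub>kG\<^esub>\<rparr>)"

end

theory Submission
  imports Defs
begin

text \<open>A matrix \<open>m\<close> in the algebra of the smash product category has its entry at \<open>(t, s)\<close> in degree
  \<open>t\<^sup>-\<^sup>1 s\<close>, so its column \<open>s\<close> lists the homogeneous components of a single, arbitrary element of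
  \<open>A\<close>, namely the sum of the column.  Sending \<open>m\<close> to the sum over \<open>s\<close> of (the sum of column \<open>s\<close>)
  tensor \<open>\<delta>\<close> at \<open>s\<^sup>-\<^sup>1\<close> is therefore a linear bijection onto the tensor product, with inverse
  \<open>a \<otimes> p \<mapsto> (p (s\<^sup>-\<^sup>1) a\<^bsub>t\<^sup>-\<^sup>1 s\<^esub>)\<^bsub>t, s\<^esub>\<close>.  The matrix product transported along it obeys the
  commutation rule that determines the product of the smash product algebra: existence of that
  product, the algebra axioms, and the isomorphism all follow from this transport.\<close>


section \<open>Linear maps\<close>

text \<open>The inverse in the Dirac mass is forced by the commutation rule. Let \<open>g\<close> be
  an entry at (u, t) and \<open>f\<close> an entry at (t', s), so \<open>f\<close> has degree t'^-1
  s. Moving \<delta> at t^-1 past \<open>f\<close> turns it into \<delta> at s^-1 t' t^-1, and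
  multiplying by \<delta> at s^-1 gives 0 unless t' = t, in which case the result is
  \<open>g f\<close> with \<delta> at s^-1. This is exactly the matrix rule; \<delta> at
  \<open>s\<close> itself would not produce it. Two obstacles shape the development. The product of
  the smash algebra is given by \<open>THE\<close>, so nothing about it, not even closure, is
  available before existence and uniqueness are proved. And elements of the tensor product are
  cosets of formal combinations, so maps out of it are obtained from the universal property, and
  equalities of linear maps on it are checked on spanning tensors. Matrices have entries instead:
  associativity and unit laws are verified there and then carried over, rather than being tested on
  triples of tensors.\<close>

locale linear_map = dom: module k M + cod: module k N
  for k :: "('k, 'r) ring_scheme" and M :: "('k, 'a, 'p) module_scheme"
    and N :: "('k, 'b, 'q) module_scheme" and f :: "'a \<Rightarrow> 'b" +
  assumes closed: "x \<in> carrier M \<Longrightarrow> f x \<in> carrier N"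
    and add: "\<lbrakk> x \<in> carrier M; y \<in> carrier M \<rbrakk> \<Longrightarrow> f (x \<oplus>\<^bsub>M\<^esub> y) = f x \<oplus>\<^bsub>N\<^esub> f y"
    and smult: "\<lbrakk> c \<in> carrier k; x \<in> carrier M \<rbrakk> \<Longrightarrow> f (c \<odot>\<^bsub>M\<^esub> x) = c \<odot>\<^bsub>N\<^esub> f x"
begin

lemma zero: "f \<zero>\<^bsub>M\<^esub> = \<zero>\<^bsub>N\<^esub>"
proof -
  have "f (\<zero>\<^bsub>k\<^esub> \<odot>\<^bsub>M\<^esub> \<zero>\<^bsub>M\<^esub>) = \<zero>\<^bsub>k\<^esub> \<odot>\<^bsub>N\<^esub> f \<zero>\<^bsub>M\<^esub>" by (intro smult) auto
  then show ?thesis by (simp add: closed)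
qed

lemma a_inv: "x \<in> carrier M \<Longrightarrow> f (\<ominus>\<^bsub>M\<^esub> x) = \<ominus>\<^bsub>N\<^esub> f x"
proof -
  assume x: "x \<in> carrier M"
  then have "f (\<ominus>\<^bsub>M\<^esub> x) \<oplus>\<^bsub>N\<^esub> f x = \<zero>\<^bsub>N\<^esub>"
    by (simp add: add[symmetric] dom.M.l_neg zero)
  then show ?thesis using x by (simp add: closed cod.M.minus_equality)
qed

lemma finsum: "g \<in> I \<rightarrow> carrier M \<Longrightarrow> f (\<Oplus>\<^bsub>M\<^esub> i \<in> I. g i) = (\<Oplus>\<^bsub>N\<^esub> i \<in> I. f (g i))"
proof (induction I rule: infinite_finite_induct)
  case (insert i I)
  then have "g \<in> I \<rightarrow> carrier M" "g i \<in> carrier M" "(\<lambda>i. f (g i)) \<in> I \<rightarrow> carrier N"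
    by (auto intro!: closed)
  with insert show ?case by (simp add: add closed)
qed (auto simp: zero)

lemma kernel_submodule: "submodule {x \<in> carrier M. f x = \<zero>\<^bsub>N\<^esub>} k M"
  by (intro dom.submoduleI) (auto simp: zero a_inv add smult)

end

lemma linear_map_compose:
  assumes "linear_map k M N f" and "linear_map k N P g"
  shows "linear_map k M P (\<lambda>x. g (f x))"
proof -
  interpret f: linear_map k M N f by fact
  interpret g: linear_map k N P g by fact
  show ?thesis by unfold_locales (auto simp: f.closed g.closed f.add g.add f.smult g.smult)
qed

lemma linear_map_id: "module k M \<Longrightarrow> linear_map k M M (\<lambda>x. x)"
  by (simp add: linear_map_def linear_map_axioms_def)

text \<open>The device behind every equality of linear maps on the tensor product: a submodule that
  contains a spanning set is everything.\<close>

lemma equalizer_submodule: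
  assumes "linear_map k M N f" and "linear_map k M N g"
  shows "submodule {x \<in> carrier M. f x = g x} k M"
proof -
  interpret f: linear_map k M N f by fact
  interpret g: linear_map k M N g by fact
  show ?thesis
    by (intro f.dom.submoduleI)
      (auto simp: f.zero g.zero f.a_inv g.a_inv f.add g.add f.smult g.smult)
qed

lemma linear_map_finsum:
  assumes M: "module k M" and N: "module k N"
    and f: "\<And>i. i \<in> I \<Longrightarrow> linear_map k M N (f i)" and I: "finite I"
  shows "linear_map k M N (\<lambda>x. \<Oplus>\<^bsub>N\<^esub> i \<in> I. f i x)"
proof -
  interpret M: module k M by fact
  interpret N: module k N by fact
  note closed = linear_map.closed[OF f]
  show ?thesis
  proof
    fix x assume x: "x \<in> carrier M"
    show "(\<Oplus>\<^bsub>N\<^esub> i \<in> I. f i x) \<in> carrier N" using x closed by auto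
    { fix y assume y: "y \<in> carrier M"
      have "(\<Oplus>\<^bsub>N\<^esub> i \<in> I. f i (x \<oplus>\<^bsub>M\<^esub> y)) = (\<Oplus>\<^bsub>N\<^esub> i \<in> I. f i x \<oplus>\<^bsub>N\<^esub> f i y)"
        using x y closed linear_map.add[OF f] by (intro N.finsum_cong') auto
      also have "\<dots> = (\<Oplus>\<^bsub>N\<^esub> i \<in> I. f i x) \<oplus>\<^bsub>N\<^esub> (\<Oplus>\<^bsub>N\<^esub> i \<in> I. f i y)"
        using x y closed by (intro N.finsum_addf) auto
      finally show "(\<Oplus>\<^bsub>N\<^esub> i \<in> I. f i (x \<oplus>\<^bsub>M\<^esub> y)) = (\<Oplus>\<^bsub>N\<^esub> i \<in> I. f i x) \<oplus>\<^bsub>N\<^esub> (\<Oplus>\<^bsub>N\<^esub> i \<in> I. f i y)" . }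
    { fix c assume c: "c \<in> carrier k"
      have "(\<Oplus>\<^bsub>N\<^esub> i \<in> I. f i (c \<odot>\<^bsub>M\<^esub> x)) = (\<Oplus>\<^bsub>N\<^esub> i \<in> I. c \<odot>\<^bsub>N\<^esub> f i x)"
        using x c closed linear_map.smult[OF f] by (intro N.finsum_cong') auto
      also have "\<dots> = c \<odot>\<^bsub>N\<^esub> (\<Oplus>\<^bsub>N\<^esub> i \<in> I. f i x)"
        using x c closed by (intro N.finsum_smult_ldistr[symmetric] I) auto
      finally show "(\<Oplus>\<^bsub>N\<^esub> i \<in> I. f i (c \<odot>\<^bsub>M\<^esub> x)) = c \<odot>\<^bsub>N\<^esub> (\<Oplus>\<^bsub>N\<^esub> i \<in> I. f i x)" . }
  qed
qed

lemma bilinear_linear_left: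
  assumes "module k M" "module k P" "bilinear k M N P b" "n \<in> carrier N"
  shows "linear_map k M P (\<lambda>m. b m n)"
  using assms by (auto simp: linear_map_def linear_map_axioms_def bilinear_def)

lemma bilinear_linear_right:
  assumes "module k N" "module k P" "bilinear k M N P b" "m \<in> carrier M"
  shows "linear_map k N P (b m)"
  using assms by (auto simp: linear_map_def linear_map_axioms_def bilinear_def)

text \<open>A sum taken in \<open>M\<close> with its carrier cut down to \<open>H\<close> and the
  same sum taken in \<open>M\<close> are formally different \<open>finsum\<close>s. Linearity of the
  inclusion identifies them. The morphism modules of a smash product category are of this restricted
  kind.\<close>

lemma submodule_inclusion_linear:
  assumes "module k M" and "submodule H k M"
  shows "linear_map k (M\<lparr>carrier := H\<rparr>) M (\<lambda>x. x)"
proof -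
  interpret M: module k M by fact
  interpret H: module k "M\<lparr>carrier := H\<rparr>"
    using assms by (rule submodule.submodule_is_module[rotated])
  show ?thesis using M.submoduleE(1)[OF assms(2)] by unfold_locales auto
qed

lemma submodule_finsum:
  assumes "module k M" and "submodule H k M" and "f \<in> I \<rightarrow> H"
  shows "(\<Oplus>\<^bsub>M\<^esub> i \<in> I. f i) \<in> H"
proof -
  interpret linear_map k "M\<lparr>carrier := H\<rparr>" M "\<lambda>x. x"
    by (rule submodule_inclusion_linear) fact+
  have "(\<Oplus>\<^bsub>M\<lparr>carrier := H\<rparr>\<^esub> i \<in> I. f i) \<in> H"
    using dom.M.finsum_closed[of f I] assms(3) by simp
  then show ?thesis using finsum[of f I] assms(3) by simp
qed

text \<open>Every element of \<open>B\<close> is some \<open>h a\<close>, so each ring law of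
  \<open>B\<close> is the image of the same law of \<open>A\<close>. Beforehand \<open>B\<close> is
  only known to be a module; this is how the smash algebra acquires its associativity.\<close>

lemma k_algebra_transport:
  assumes A: "k_algebra k A" and h: "linear_map k A B h" and bij: "bij_betw h (carrier A) (carrier B)"
    and mult: "\<And>a b. \<lbrakk> a \<in> carrier A; b \<in> carrier A \<rbrakk> \<Longrightarrow> h (a \<otimes>\<^bsub>A\<^esub> b) = h a \<otimes>\<^bsub>B\<^esub> h b"
    and one: "h \<one>\<^bsub>A\<^esub> = \<one>\<^bsub>B\<^esub>"
  shows "k_algebra k B" and "h \<in> k_algebra_iso k A B"
proof -
  interpret A: k_algebra k A by fact
  interpret h: linear_map k A B h by fact
  have carrier: "carrier B = h ` carrier A" using bij by (simp add: bij_betw_def)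
  have "ring A" by (rule k_algebra.axioms(2)[OF A])
  note A_ring = ring.is_monoid[OF this] monoid.m_assoc[OF ring.is_monoid[OF this]]
  have "ring B"
    by (intro ringI h.cod.abelian_group_axioms monoidI)
      (auto simp: carrier mult[symmetric] one[symmetric] h.add[symmetric] A_ring
        A.l_distr A.r_distr)
  then show "k_algebra k B"
    by (intro k_algebra.intro k_algebra_axioms.intro h.cod.module_axioms)
      (auto simp: carrier mult[symmetric] h.smult[symmetric] A.smult_mult_l A.smult_mult_r)
  show "h \<in> k_algebra_iso k A B"
    using bij by (simp add: k_algebra_iso_def ring_iso_def ring_hom_memI h.closed mult h.add one h.smult)
qed

text \<open>The module axioms do not mention \<open>mult\<close> and \<open>one\<close>. This
  bridges records that differ only there: the free module and a module of functions, the smash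
  algebra and the tensor product.\<close>

lemma module_mult_one_update:
  fixes M :: "('k, 'a, 'p) module_scheme"
  assumes "module k M"
  shows "module k (M\<lparr>mult := m, one := e\<rparr>)"
proof -
  interpret module k M by fact
  show ?thesis
    using M.a_comm_group M.abelian_monoid_axioms
    by (intro moduleI abelian_group.intro abelian_group_axioms.intro)
      (auto simp: abelian_monoid_def smult_l_distr smult_r_distr smult_assoc1 intro: R.is_cring)
qed


section \<open>Product, free and quotient modules\<close>

text \<open>All laws hold coordinatewise. \<open>m\<close> and \<open>e\<close> stay arbitrary so
  that one lemma covers the function algebra (constant family \<open>k\<close>) and the category
  algebra (family of morphism modules).\<close>

lemma module_PiE:
  assumes k: "cring k" and M: "\<And>i. i \<in> I \<Longrightarrow> module k (M i)"
  shows "module k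
    \<lparr>carrier = (\<Pi>\<^sub>E i \<in> I. carrier (M i)), mult = m, one = e,
     zero = (\<lambda>i \<in> I. \<zero>\<^bsub>M i\<^esub>),
     add = (\<lambda>f g. \<lambda>i \<in> I. f i \<oplus>\<^bsub>M i\<^esub> g i),
     smult = (\<lambda>c f. \<lambda>i \<in> I. c \<odot>\<^bsub>M i\<^esub> f i)\<rparr>" (is "module k ?P")
proof -
  interpret k: cring k by fact
  have ag: "abelian_group (M i)" if "i \<in> I" for i
    using M[OF that] by (simp add: module_def)
  have am: "abelian_monoid (M i)" if "i \<in> I" for i
    using ag[OF that] by (simp add: abelian_group_def)
  show ?thesis
  proof (rule moduleI)
    show "abelian_group ?P"
    proof (rule abelian_groupI)
      fix x assume x: "x \<in> carrier ?P"
      show "\<exists>y\<in>carrier ?P. y \<oplus>\<^bsub>?P\<^esub> x = \<zero>\<^bsub>?P\<^esub>"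
        using x abelian_group.l_neg[OF ag] abelian_group.a_inv_closed[OF ag]
        by (intro bexI[of _ "\<lambda>i\<in>I. \<ominus>\<^bsub>M i\<^esub> x i"])
          (auto intro!: restrict_ext simp: PiE_iff)
      show "\<zero>\<^bsub>?P\<^esub> \<oplus>\<^bsub>?P\<^esub> x = x"
        using x abelian_monoid.l_zero[OF am]
        by (intro ext) (auto simp: PiE_iff extensional_def restrict_def)
    qed (auto simp: PiE_iff abelian_monoid.a_closed[OF am] abelian_monoid.zero_closed[OF am]
        abelian_monoid.a_assoc[OF am] abelian_monoid.a_comm[OF am] abelian_monoid.a_lcomm[OF am] intro!: restrict_ext)
    fix x assume x: "x \<in> carrier ?P"
    show "\<one>\<^bsub>k\<^esub> \<odot>\<^bsub>?P\<^esub> x = x"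
      using x module.smult_one[OF M]
      by (intro ext) (auto simp: PiE_iff extensional_def restrict_def)
  qed (auto simp: k PiE_iff module.smult_closed[OF M] module.smult_l_distr[OF M]
      module.smult_r_distr[OF M] module.smult_assoc1[OF M] intro!: restrict_ext)
qed

lemma function_algebra_module:
  assumes "cring k" shows "module k (function_algebra k X)"
proof -
  interpret cring k by fact
  let ?K = "\<lparr>carrier = carrier k, mult = mult k, one = \<one>\<^bsub>k\<^esub>, zero = \<zero>\<^bsub>k\<^esub>, add = add k,
    smult = mult k\<rparr>"
  have "module k ?K"
  proof (rule moduleI)
    show "abelian_group ?K"
      by (rule abelian_groupI) (auto simp: a_ac intro: bexI[of _ "\<ominus>\<^bsub>k\<^esub> x" for x] l_neg)
  qed (auto simp: l_distr r_distr m_assoc assms)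
  then show ?thesis
    using module_PiE[OF assms, of X "\<lambda>_. ?K"] by (simp add: function_algebra_def)
qed

lemma dirac_closed: "cring k \<Longrightarrow> dirac k X x \<in> X \<rightarrow>\<^sub>E carrier k"
  by (auto simp: dirac_def cring.cring_simprules)

lemma finsum_dirac:
  assumes k: "cring k" and X: "finite X" and p: "p \<in> X \<rightarrow>\<^sub>E carrier k"
  shows "(\<Oplus>\<^bsub>function_algebra k X\<^esub> x \<in> X. p x \<odot>\<^bsub>function_algebra k X\<^esub> dirac k X x) = p"
proof -
  let ?F = "function_algebra k X"
  interpret cring k by fact
  interpret F: module k ?F by (rule function_algebra_module) fact
  have summand: "p x \<odot>\<^bsub>?F\<^esub> dirac k X x \<in> carrier ?F" if "x \<in> X" for x
    using that p dirac_closed[OF k, of X x] by (intro F.smult_closed) (auto simp: function_algebra_def)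
  \<comment> \<open>Generalised to partial sums for the induction: summing over \<open>S\<close>
    yields \<open>p\<close> cut off to \<open>S\<close>.\<close>
  have "(\<Oplus>\<^bsub>?F\<^esub> x \<in> S. p x \<odot>\<^bsub>?F\<^esub> dirac k X x) =
      (\<lambda>y \<in> X. if y \<in> S then p y else \<zero>\<^bsub>k\<^esub>)" if "S \<subseteq> X" for S
    using finite_subset[OF that X] that
  proof (induction S rule: finite_induct)
    case empty
    show ?case unfolding F.M.finsum_empty by (simp add: function_algebra_def)
  next
    case (insert x S)
    have "(\<Oplus>\<^bsub>?F\<^esub> x \<in> insert x S. p x \<odot>\<^bsub>?F\<^esub> dirac k X x) = (p x \<odot>\<^bsub>?F\<^esub> dirac k X x) \<oplus>\<^bsub>?F\<^esub>
        (\<lambda>y \<in> X. if y \<in> S then p y else \<zero>\<^bsub>k\<^esub>)"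
      using insert summand by (subst F.M.finsum_insert) (auto simp: restrict_def)
    also have "\<dots> = (\<lambda>y \<in> X. if y \<in> insert x S then p y else \<zero>\<^bsub>k\<^esub>)"
      using insert.hyps insert.prems PiE_mem[OF p]
      by (intro ext) (auto simp: function_algebra_def dirac_def)
    finally show ?case .
  qed
  from this[of X] show ?thesis
    using p by (auto simp: fun_eq_iff PiE_iff extensional_def)
qed

text \<open>Up to product and unit, the free module is the submodule of finitely supported functions
  inside \<open>function_algebra k X\<close>.\<close>

lemma free_module_module:
  assumes "cring k" shows "module k (free_module k X)"
proof -
  interpret cring k by fact
  let ?F = "function_algebra k X" and ?H = "{p \<in> X \<rightarrow>\<^sub>E carrier k. finite {x \<in> X. p x \<noteq> \<zero>\<^bsub>k\<^esub>}}"
  interpret F: module k ?F by (rule function_algebra_module) fact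
  have "submodule ?H k ?F"
  proof (rule F.submoduleI)
    fix p assume p: "p \<in> ?H"
    have minus: "\<ominus>\<^bsub>?F\<^esub> p = (\<lambda>x \<in> X. \<ominus>\<^bsub>k\<^esub> p x)"
      using p by (intro F.M.minus_equality)
        (auto simp: function_algebra_def PiE_iff l_neg intro!: restrict_ext)
    have "finite {x \<in> X. \<ominus>\<^bsub>k\<^esub> p x \<noteq> \<zero>\<^bsub>k\<^esub>}"
      using p by (elim CollectE conjE) (erule finite_subset[rotated], auto)
    then show "\<ominus>\<^bsub>?F\<^esub> p \<in> ?H"
      using p unfolding minus by (auto simp: PiE_iff cong: conj_cong)
    { fix q assume q: "q \<in> ?H"
      have "finite ({x \<in> X. p x \<noteq> \<zero>\<^bsub>k\<^esub>} \<union> {x \<in> X. q x \<noteq> \<zero>\<^bsub>k\<^esub>})" using p q by simp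
      then have "finite {x \<in> X. p x \<oplus>\<^bsub>k\<^esub> q x \<noteq> \<zero>\<^bsub>k\<^esub>}" by (rule finite_subset[rotated]) auto
      then show "p \<oplus>\<^bsub>?F\<^esub> q \<in> ?H"
        using p q by (auto simp: function_algebra_def PiE_iff cong: conj_cong) }
    { fix c assume c: "c \<in> carrier k"
      have "finite {x \<in> X. c \<otimes>\<^bsub>k\<^esub> p x \<noteq> \<zero>\<^bsub>k\<^esub>}"
        using p c by (elim CollectE conjE) (erule finite_subset[rotated], auto)
      then show "c \<odot>\<^bsub>?F\<^esub> p \<in> ?H"
        using p c by (auto simp: function_algebra_def PiE_iff cong: conj_cong) }
  qed (auto simp: function_algebra_def cong: conj_cong)
  from module_mult_one_update[OF submodule.submodule_is_module[OF this F.module_axioms],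
      of undefined undefined]
  show ?thesis by (simp add: function_algebra_def free_module_def)
qed

lemma dirac_free_module:
  assumes "cring k" and "x \<in> X" shows "dirac k X x \<in> carrier (free_module k X)"
proof -
  have "finite {y \<in> X. dirac k X x y \<noteq> \<zero>\<^bsub>k\<^esub>}"
    by (rule finite_subset[of _ "{x}"]) (auto simp: dirac_def split: if_splits)
  then show ?thesis using dirac_closed[OF assms(1), of X x] by (simp add: free_module_def)
qed

text \<open>Induction on the support: resetting one nonzero value of \<open>p\<close> to zero
  shrinks the support, and what was removed is a multiple of a Dirac function.\<close>

lemma free_module_spanned:
  assumes k: "cring k" and H: "submodule H k (free_module k X)"
    and dirac: "\<And>x. x \<in> X \<Longrightarrow> dirac k X x \<in> H"
  shows "carrier (free_module k X) \<subseteq> H"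
proof
  interpret cring k by fact
  interpret F: module k "free_module k X" by (rule free_module_module) fact
  note H' = F.submoduleE[OF H]
  have "p \<in> H" if "finite S" "p \<in> X \<rightarrow>\<^sub>E carrier k" "{x \<in> X. p x \<noteq> \<zero>\<^bsub>k\<^esub>} = S" for p S
    using that
  proof (induction S arbitrary: p)
    case empty
    then have "p = \<zero>\<^bsub>free_module k X\<^esub>"
      by (auto simp: free_module_def restrict_def fun_eq_iff PiE_iff extensional_def)
    moreover have "\<zero>\<^bsub>free_module k X\<^esub> \<in> H"
      using H by (auto simp: submodule_def dest: subgroup.one_closed)
    ultimately show ?case by simp
  next
    case (insert x S)
    then have x: "x \<in> X" by auto
    let ?q = "p(x := \<zero>\<^bsub>k\<^esub>)"
    have "?q \<in> H" using insert x by (intro insert.IH) (auto simp: PiE_iff extensional_def)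
    moreover have "p x \<odot>\<^bsub>free_module k X\<^esub> dirac k X x \<in> H"
      using insert.prems x by (intro H'(4) dirac) (auto simp: PiE_iff)
    moreover have "p = ?q \<oplus>\<^bsub>free_module k X\<^esub> (p x \<odot>\<^bsub>free_module k X\<^esub> dirac k X x)"
      using insert.prems x
      by (intro ext) (auto simp: free_module_def dirac_def PiE_iff extensional_def)
    ultimately show ?case using H'(5) by metis
  qed
  then show "p \<in> H" if "p \<in> carrier (free_module k X)" for p
    using that by (auto simp: free_module_def)
qed

text \<open>The linear extension sums over the support of its argument, an index set that varies
  with the argument. \<open>g_eq\<close> allows any finite set containing the support, so additivity
  can be compared over the union of two supports.\<close>

lemma free_module_lift:
  fixes k :: "('k, 'r) ring_scheme" and X :: "'x set"
  assumes N: "module k N" and b: "b \<in> X \<rightarrow> carrier N"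
  shows "\<exists>g. linear_map k (free_module k X) N g \<and> (\<forall>x \<in> X. g (dirac k X x) = b x)"
proof -
  interpret N: module k N by fact
  interpret F: module k "free_module k X" by (rule free_module_module) (rule N.R.is_cring)
  have b': "b x \<in> carrier N" if "x \<in> X" for x using b that by auto
  define supp where "supp p = {x \<in> X. p x \<noteq> \<zero>\<^bsub>k\<^esub>}" for p :: "'x \<Rightarrow> 'k"
  define g where "g p = (\<Oplus>\<^bsub>N\<^esub> x \<in> supp p. p x \<odot>\<^bsub>N\<^esub> b x)" for p
  have summand: "p x \<odot>\<^bsub>N\<^esub> b x \<in> carrier N" if "p \<in> X \<rightarrow> carrier k" "x \<in> X" for p x
    using that b' by (auto simp: Pi_iff)
  have g_eq: "g p = (\<Oplus>\<^bsub>N\<^esub> x \<in> S. p x \<odot>\<^bsub>N\<^esub> b x)"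
    if S: "finite S" "S \<subseteq> X" "supp p \<subseteq> S" and p: "p \<in> X \<rightarrow> carrier k" for p S
    unfolding g_def
  proof (rule N.add.finprod_mono_neutral_cong_left)
    show "p x \<odot>\<^bsub>N\<^esub> b x = \<zero>\<^bsub>N\<^esub>" if "x \<in> S - supp p" for x
    proof -
      have "x \<in> X" "p x = \<zero>\<^bsub>k\<^esub>" using that S by (auto simp: supp_def)
      then show ?thesis by (simp add: b')
    qed
  qed (use S summand[OF p] in auto)
  have "linear_map k (free_module k X) N g"
  proof
    fix p assume p: "p \<in> carrier (free_module k X)"
    then have P: "p \<in> X \<rightarrow> carrier k" "finite (supp p)" "supp p \<subseteq> X"
      by (auto simp: supp_def free_module_def)
    show "g p \<in> carrier N"
      unfolding g_def using P summand by (intro N.finsum_closed) auto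
    { fix q assume q: "q \<in> carrier (free_module k X)"
      let ?r = "p \<oplus>\<^bsub>free_module k X\<^esub> q" and ?S = "supp p \<union> supp q"
      have Q: "q \<in> X \<rightarrow> carrier k" "finite (supp q)" "supp q \<subseteq> X"
        using q by (auto simp: supp_def free_module_def)
      have R: "?r x = p x \<oplus>\<^bsub>k\<^esub> q x" if "x \<in> X" for x
        using that by (simp add: free_module_def)
      have "g ?r = (\<Oplus>\<^bsub>N\<^esub> x \<in> ?S. ?r x \<odot>\<^bsub>N\<^esub> b x)"
        using P Q R by (intro g_eq) (auto simp: Pi_iff supp_def)
      also have "\<dots> = (\<Oplus>\<^bsub>N\<^esub> x \<in> ?S. p x \<odot>\<^bsub>N\<^esub> b x \<oplus>\<^bsub>N\<^esub> q x \<odot>\<^bsub>N\<^esub> b x)"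
      proof (intro N.finsum_cong')
        fix x assume "x \<in> ?S"
        then have "x \<in> X" using P Q by auto
        then show "?r x \<odot>\<^bsub>N\<^esub> b x = p x \<odot>\<^bsub>N\<^esub> b x \<oplus>\<^bsub>N\<^esub> q x \<odot>\<^bsub>N\<^esub> b x"
          using P Q b' by (simp add: R N.smult_l_distr Pi_iff)
      qed (use P Q summand in auto)
      also have "\<dots> = (\<Oplus>\<^bsub>N\<^esub> x \<in> ?S. p x \<odot>\<^bsub>N\<^esub> b x) \<oplus>\<^bsub>N\<^esub> (\<Oplus>\<^bsub>N\<^esub> x \<in> ?S. q x \<odot>\<^bsub>N\<^esub> b x)"
        using P Q summand by (intro N.finsum_addf) auto
      also have "\<dots> = g p \<oplus>\<^bsub>N\<^esub> g q"
        using P Q by (subst (1 2) g_eq[of ?S]) auto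
      finally show "g ?r = g p \<oplus>\<^bsub>N\<^esub> g q" . }
    { fix c assume c: "c \<in> carrier k"
      let ?r = "c \<odot>\<^bsub>free_module k X\<^esub> p"
      have R: "?r x = c \<otimes>\<^bsub>k\<^esub> p x" if "x \<in> X" for x
        using that by (simp add: free_module_def)
      have "g ?r = (\<Oplus>\<^bsub>N\<^esub> x \<in> supp p. ?r x \<odot>\<^bsub>N\<^esub> b x)"
        using P c R by (intro g_eq) (auto simp: Pi_iff supp_def)
      also have "\<dots> = (\<Oplus>\<^bsub>N\<^esub> x \<in> supp p. c \<odot>\<^bsub>N\<^esub> (p x \<odot>\<^bsub>N\<^esub> b x))"
      proof (intro N.finsum_cong')
        fix x assume "x \<in> supp p"
        then have "x \<in> X" using P by auto
        then show "?r x \<odot>\<^bsub>N\<^esub> b x = c \<odot>\<^bsub>N\<^esub> (p x \<odot>\<^bsub>N\<^esub> b x)"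
          using P c b' by (simp add: R N.smult_assoc1 Pi_iff)
      qed (use P c summand in auto)
      also have "\<dots> = c \<odot>\<^bsub>N\<^esub> g p"
        unfolding g_def using P c summand by (intro N.finsum_smult_ldistr[symmetric]) auto
      finally show "g ?r = c \<odot>\<^bsub>N\<^esub> g p" . }
  qed
  moreover have "g (dirac k X x) = b x" if "x \<in> X" for x
  proof -
    have "g (dirac k X x) = (\<Oplus>\<^bsub>N\<^esub> y \<in> {x}. dirac k X x y \<odot>\<^bsub>N\<^esub> b y)"
      using that dirac_closed[OF N.R.is_cring, of X x]
      by (intro g_eq) (auto simp: supp_def dirac_def)
    also have "\<dots> = b x" using that b' by (simp add: dirac_def)
    finally show ?thesis .
  qed
  ultimately show ?thesis by blast
qed

text \<open>In \<open>quotient_module\<close> a scalar multiple of a coset is a union of cosets, one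
  for each representative. They all coincide because \<open>N\<close> is closed under scalars. The
  module axioms then pass from \<open>M\<close> to the quotient, since every coset is in the image
  of the quotient map.\<close>

lemma quotient_map_linear:
  assumes "module k M" and N: "submodule N k M"
  shows "linear_map k M (quotient_module M N) (\<lambda>x. N +>\<^bsub>M\<^esub> x)"
proof -
  interpret M: module k M by fact
  interpret N: abelian_subgroup N M
    using N by (intro abelian_subgroupI3 additive_subgroupI M.abelian_group_axioms)
      (simp add: submodule_def)
  note NE = M.submoduleE[OF N]
  have sub: "x \<in> carrier M" if "x \<in> N" for x using NE(1) that by blast
  let ?Q = "quotient_module M N" and ?q = "\<lambda>x. N +>\<^bsub>M\<^esub> x"
  have add: "?q x \<oplus>\<^bsub>?Q\<^esub> ?q y = ?q (x \<oplus>\<^bsub>M\<^esub> y)" if "x \<in> carrier M" "y \<in> carrier M" for x y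
    using that by (simp add: quotient_module_def N.a_rcos_sum)
  have closed: "?q x \<in> carrier ?Q" if "x \<in> carrier M" for x
    using that by (simp add: quotient_module_def M.a_rcosetsI[OF NE(1)])
  have shift: "?q (n \<oplus>\<^bsub>M\<^esub> x) = ?q x" if "n \<in> N" "x \<in> carrier M" for n x
    using that M.a_coset_add_assoc[OF NE(1) sub[OF that(1)] that(2)] by (simp add: N.a_rcos_const)
  have smult: "c \<odot>\<^bsub>?Q\<^esub> ?q x = ?q (c \<odot>\<^bsub>M\<^esub> x)" if c: "c \<in> carrier k" and x: "x \<in> carrier M" for c x
  proof -
    have coset_eq: "?q (c \<odot>\<^bsub>M\<^esub> y) = ?q (c \<odot>\<^bsub>M\<^esub> x)" if "y \<in> ?q x" for y
    proof -
      obtain n where n: "n \<in> N" "y = n \<oplus>\<^bsub>M\<^esub> x" using \<open>y \<in> ?q x\<close> by (auto simp: a_r_coset_def')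
      then show ?thesis using c x sub NE(4) by (simp add: M.smult_r_distr shift)
    qed
    have "(\<Union>y \<in> ?q x. ?q (c \<odot>\<^bsub>M\<^esub> y)) = ?q (c \<odot>\<^bsub>M\<^esub> x)"
      by (rule UN_constant_eq) (rule N.a_rcos_self[OF x], intro ballI coset_eq)
    then show ?thesis by (simp add: quotient_module_def)
  qed
  have zero: "\<zero>\<^bsub>?Q\<^esub> = ?q \<zero>\<^bsub>M\<^esub>"
    by (simp add: quotient_module_def M.a_coset_add_zero[OF NE(1)])
  have carrier: "carrier ?Q = ?q ` carrier M"
    by (auto simp: quotient_module_def A_RCOSETS_def')
  interpret Q: module k ?Q
  proof (rule moduleI)
    show "abelian_group ?Q"
    proof (rule abelian_groupI)
      show "\<exists>Y\<in>carrier ?Q. Y \<oplus>\<^bsub>?Q\<^esub> X = \<zero>\<^bsub>?Q\<^esub>" if "X \<in> carrier ?Q" for X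
      proof -
        obtain x where x: "x \<in> carrier M" "X = ?q x" using \<open>X \<in> carrier ?Q\<close> carrier by auto
        then have "?q (\<ominus>\<^bsub>M\<^esub> x) \<oplus>\<^bsub>?Q\<^esub> X = \<zero>\<^bsub>?Q\<^esub>" by (simp add: add zero M.l_neg)
        with x closed[of "\<ominus>\<^bsub>M\<^esub> x"] show ?thesis by auto
      qed
    qed (auto simp: carrier add zero M.a_ac)
  qed (auto simp: carrier add smult M.smult_l_distr M.smult_r_distr M.smult_assoc1
      intro: M.R.is_cring)
  show ?thesis by unfold_locales (auto simp: closed add smult)
qed

lemma quotient_module_lift:
  assumes f: "linear_map k M P f" and N: "submodule N k M"
    and kernel: "\<And>x. x \<in> N \<Longrightarrow> f x = \<zero>\<^bsub>P\<^esub>"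
  shows "\<exists>g. linear_map k (quotient_module M N) P g \<and> (\<forall>x \<in> carrier M. g (N +>\<^bsub>M\<^esub> x) = f x)"
proof -
  interpret f: linear_map k M P f by fact
  interpret q: linear_map k M "quotient_module M N" "\<lambda>x. N +>\<^bsub>M\<^esub> x"
    by (rule quotient_map_linear[OF f.dom.module_axioms N])
  note NE = f.dom.submoduleE[OF N]
  \<comment> \<open>The choice of representative is harmless: any other differs from it by an
    element of \<open>N\<close>, where \<open>f\<close> vanishes.\<close>
  define g where "g X = f (SOME x. x \<in> X)" for X
  have g: "g (N +>\<^bsub>M\<^esub> x) = f x" if x: "x \<in> carrier M" for x
  proof -
    have "\<zero>\<^bsub>M\<^esub> \<in> N" using N by (auto simp: submodule_def dest: subgroup.one_closed)
    then have "x \<in> N +>\<^bsub>M\<^esub> x" using x by (force simp: a_r_coset_def')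
    then have "(SOME y. y \<in> N +>\<^bsub>M\<^esub> x) \<in> N +>\<^bsub>M\<^esub> x" by (rule someI)
    then obtain n where n: "n \<in> N" "(SOME y. y \<in> N +>\<^bsub>M\<^esub> x) = n \<oplus>\<^bsub>M\<^esub> x"
      by (auto simp: a_r_coset_def')
    moreover have "n \<in> carrier M" using n NE(1) by blast
    ultimately show ?thesis using x by (simp add: g_def f.add kernel f.closed)
  qed
  have carrier: "carrier (quotient_module M N) = (\<lambda>x. N +>\<^bsub>M\<^esub> x) ` carrier M"
    by (auto simp: quotient_module_def A_RCOSETS_def')
  have "linear_map k (quotient_module M N) P g"
    by unfold_locales
      (auto simp: carrier g f.closed f.add f.smult q.add[symmetric] q.smult[symmetric])
  with g show ?thesis by blast
qed


section \<open>The universal property of the tensor product\<close>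

lemma tensor_relations_closed:
  assumes "module k M" and "module k N"
  shows "tensor_relations k M N \<subseteq> carrier (free_module k (carrier M \<times> carrier N))"
proof -
  interpret M: module k M by fact
  interpret N: module k N by fact
  interpret F: module k "free_module k (carrier M \<times> carrier N)"
    by (rule free_module_module) (rule M.R.is_cring)
  have "dirac k (carrier M \<times> carrier N) (m, n) \<in> carrier (free_module k (carrier M \<times> carrier N))"
    if "m \<in> carrier M" "n \<in> carrier N" for m n
    using that by (simp add: dirac_free_module M.R.is_cring)
  then show ?thesis by (auto simp: tensor_relations_def Let_def)
qed

lemma tensor_kernel_submodule:
  assumes "module k M" and "module k N"
  shows "submodule (tensor_kernel k M N) k (free_module k (carrier M \<times> carrier N))"
proof -
  interpret M: module k M by fact
  let ?F = "free_module k (carrier M \<times> carrier N)"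
  interpret F: module k ?F by (rule free_module_module) (rule M.R.is_cring)
  let ?S = "{H. submodule H k ?F \<and> tensor_relations k M N \<subseteq> H}"
  \<comment> \<open>The hull is an intersection; having the whole free module in the family keeps
    that intersection inside the carrier.\<close>
  have "carrier ?F \<in> ?S"
    using tensor_relations_closed[OF assms] F.carrier_is_submodule by simp
  then have "\<Inter>?S \<subseteq> carrier ?F" by blast
  moreover have "\<zero>\<^bsub>?F\<^esub> \<in> H" if "submodule H k ?F" for H
    using that by (auto simp: submodule_def dest: subgroup.one_closed)
  ultimately have "submodule (\<Inter>?S) k ?F"
    by (intro F.submoduleI)
      (simp_all add: F.submoduleE(3-5))
  then show ?thesis by (simp add: tensor_kernel_def hull_def)
qed

text \<open>Through this lemma each of the four families of relations becomes one clause of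
  \<open>tensor_bilinear\<close>.\<close>

lemma tensor_kernel_coset_eq:
  assumes "module k M" and "module k N"
    and "p \<ominus>\<^bsub>free_module k (carrier M \<times> carrier N)\<^esub> q \<in> tensor_relations k M N"
    and "p \<in> carrier (free_module k (carrier M \<times> carrier N))"
    and "q \<in> carrier (free_module k (carrier M \<times> carrier N))"
  shows "tensor_kernel k M N +>\<^bsub>free_module k (carrier M \<times> carrier N)\<^esub> p =
    tensor_kernel k M N +>\<^bsub>free_module k (carrier M \<times> carrier N)\<^esub> q"
proof -
  interpret M: module k M by fact
  let ?F = "free_module k (carrier M \<times> carrier N)" and ?N = "tensor_kernel k M N"
  interpret F: module k ?F by (rule free_module_module) (rule M.R.is_cring)
  note sub = tensor_kernel_submodule[OF assms(1,2)]
  interpret N: abelian_subgroup ?N ?F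
    using sub by (intro abelian_subgroupI3 additive_subgroupI F.abelian_group_axioms)
      (simp add: submodule_def)
  have "p \<ominus>\<^bsub>?F\<^esub> q \<in> ?N" using assms(3) unfolding tensor_kernel_def by (rule hull_inc)
  then have "p \<in> ?N +>\<^bsub>?F\<^esub> q" using N.a_rcos_module[OF assms(5,4)] by (simp add: a_minus_def)
  then show ?thesis using N.a_repr_independence'[OF _ assms(5)] by simp
qed

lemma tensor_product_module:
  assumes "module k M" and "module k N"
  shows "module k (tensor_product k M N)"
proof -
  interpret M: module k M by fact
  interpret linear_map k "free_module k (carrier M \<times> carrier N)" "tensor_product k M N"
      "\<lambda>p. tensor_kernel k M N +>\<^bsub>free_module k (carrier M \<times> carrier N)\<^esub> p"
    unfolding tensor_product_def using M.R.is_cring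
    by (intro quotient_map_linear free_module_module tensor_kernel_submodule assms)
  show ?thesis by (rule cod.module_axioms)
qed

lemma tensor_bilinear:
  assumes "module k M" and "module k N"
  shows "bilinear k M N (tensor_product k M N) (tensor k M N)"
proof -
  interpret M: module k M by fact
  interpret N: module k N by fact
  let ?X = "carrier M \<times> carrier N" and ?T = "tensor_product k M N" and ?t = "tensor k M N"
  let ?F = "free_module k ?X"
  interpret F: module k ?F by (rule free_module_module) (rule M.R.is_cring)
  interpret q: linear_map k ?F ?T "\<lambda>p. tensor_kernel k M N +>\<^bsub>?F\<^esub> p"
    unfolding tensor_product_def
    by (intro quotient_map_linear F.module_axioms tensor_kernel_submodule assms)
  define e where "e m n = dirac k ?X (m, n)" for m n
  have e: "e m n \<in> carrier ?F" if "m \<in> carrier M" "n \<in> carrier N" for m n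
    using that unfolding e_def by (simp add: dirac_free_module M.R.is_cring)
  have t: "?t m n = tensor_kernel k M N +>\<^bsub>?F\<^esub> e m n" for m n
    by (simp add: tensor_def e_def)
  note eq = tensor_kernel_coset_eq[OF assms]
  show ?thesis
    unfolding bilinear_def
  proof (intro conjI ballI)
    fix m n assume m: "m \<in> carrier M" and n: "n \<in> carrier N"
    show "?t m n \<in> carrier ?T" using m n by (simp add: t q.closed e)
    { fix m' assume m': "m' \<in> carrier M"
      have "e (m \<oplus>\<^bsub>M\<^esub> m') n \<ominus>\<^bsub>?F\<^esub> (e m n \<oplus>\<^bsub>?F\<^esub> e m' n) \<in> tensor_relations k M N"
        using m m' n unfolding tensor_relations_def Let_def e_def by blast
      from eq[OF this] m m' n show "?t (m \<oplus>\<^bsub>M\<^esub> m') n = ?t m n \<oplus>\<^bsub>?T\<^esub> ?t m' n"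
        by (simp add: t e q.add[symmetric]) }
    { fix n' assume n': "n' \<in> carrier N"
      have "e m (n \<oplus>\<^bsub>N\<^esub> n') \<ominus>\<^bsub>?F\<^esub> (e m n \<oplus>\<^bsub>?F\<^esub> e m n') \<in> tensor_relations k M N"
        using m n n' unfolding tensor_relations_def Let_def e_def by blast
      from eq[OF this] m n n' show "?t m (n \<oplus>\<^bsub>N\<^esub> n') = ?t m n \<oplus>\<^bsub>?T\<^esub> ?t m n'"
        by (simp add: t e q.add[symmetric]) }
    { fix c assume c: "c \<in> carrier k"
      have "e (c \<odot>\<^bsub>M\<^esub> m) n \<ominus>\<^bsub>?F\<^esub> (c \<odot>\<^bsub>?F\<^esub> e m n) \<in> tensor_relations k M N"
        using m n c unfolding tensor_relations_def Let_def e_def by blast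
      from eq[OF this] m n c show "?t (c \<odot>\<^bsub>M\<^esub> m) n = c \<odot>\<^bsub>?T\<^esub> ?t m n"
        by (simp add: t e q.smult[symmetric])
      have "e m (c \<odot>\<^bsub>N\<^esub> n) \<ominus>\<^bsub>?F\<^esub> (c \<odot>\<^bsub>?F\<^esub> e m n) \<in> tensor_relations k M N"
        using m n c unfolding tensor_relations_def Let_def e_def by blast
      from eq[OF this] m n c show "?t m (c \<odot>\<^bsub>N\<^esub> n) = c \<odot>\<^bsub>?T\<^esub> ?t m n"
        by (simp add: t e q.smult[symmetric]) }
  qed
qed

text \<open>The preimage of \<open>H\<close> under the quotient map is a submodule containing all
  Dirac functions, hence the whole free module.\<close>

lemma tensor_product_spanned:
  assumes "module k M" and "module k N" and H: "submodule H k (tensor_product k M N)"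
    and tensor: "\<And>m n. \<lbrakk> m \<in> carrier M; n \<in> carrier N \<rbrakk> \<Longrightarrow> tensor k M N m n \<in> H"
  shows "carrier (tensor_product k M N) \<subseteq> H"
proof -
  interpret M: module k M by fact
  let ?X = "carrier M \<times> carrier N" and ?T = "tensor_product k M N"
  let ?F = "free_module k ?X" and ?q = "\<lambda>p. tensor_kernel k M N +>\<^bsub>free_module k ?X\<^esub> p"
  interpret F: module k ?F by (rule free_module_module) (rule M.R.is_cring)
  interpret q: linear_map k ?F ?T ?q
    unfolding tensor_product_def
    by (intro quotient_map_linear F.module_axioms tensor_kernel_submodule assms)
  note HE = q.cod.submoduleE[OF H]
  have "\<zero>\<^bsub>?T\<^esub> \<in> H" using H by (auto simp: submodule_def dest: subgroup.one_closed)
  then have "submodule {p \<in> carrier ?F. ?q p \<in> H} k ?F"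
    using HE by (intro F.submoduleI) (auto simp: q.zero q.a_inv q.add q.smult)
  then have "carrier ?F \<subseteq> {p \<in> carrier ?F. ?q p \<in> H}"
    using tensor by (intro free_module_spanned M.R.is_cring)
      (auto simp: tensor_def dirac_free_module M.R.is_cring)
  then show ?thesis
    by (auto simp: tensor_product_def quotient_module_def A_RCOSETS_def')
qed

lemma tensor_product_lift:
  assumes "module k M" and "module k N" and P: "module k P" and b: "bilinear k M N P b"
  shows "\<exists>g. linear_map k (tensor_product k M N) P g \<and>
    (\<forall>m \<in> carrier M. \<forall>n \<in> carrier N. g (tensor k M N m n) = b m n)"
proof -
  interpret M: module k M by fact
  interpret N: module k N by fact
  interpret P: module k P by fact
  let ?X = "carrier M \<times> carrier N"
  let ?F = "free_module k ?X"
  have "(\<lambda>(m, n). b m n) \<in> ?X \<rightarrow> carrier P" using b by (auto simp: bilinear_def)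
  from free_module_lift[OF P this] obtain f where f: "linear_map k ?F P f"
    and f_dirac: "\<And>m n. \<lbrakk> m \<in> carrier M; n \<in> carrier N \<rbrakk> \<Longrightarrow> f (dirac k ?X (m, n)) = b m n"
    by auto
  interpret f: linear_map k ?F P f by fact
  let ?K = "{p \<in> carrier ?F. f p = \<zero>\<^bsub>P\<^esub>}"
  have minus: "f (p \<ominus>\<^bsub>?F\<^esub> q) = f p \<ominus>\<^bsub>P\<^esub> f q" if "p \<in> carrier ?F" "q \<in> carrier ?F" for p q
    using that by (simp add: a_minus_def f.add f.a_inv)
  have e: "dirac k ?X (m, n) \<in> carrier ?F" if "m \<in> carrier M" "n \<in> carrier N" for m n
    using that by (simp add: dirac_free_module M.R.is_cring)
  have bc: "b m n \<in> carrier P" if "m \<in> carrier M" "n \<in> carrier N" for m n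
    using b that by (simp add: bilinear_def)
  have b1: "b (m \<oplus>\<^bsub>M\<^esub> m') n = b m n \<oplus>\<^bsub>P\<^esub> b m' n"
    if "m \<in> carrier M" "m' \<in> carrier M" "n \<in> carrier N" for m m' n
    using b that by (simp add: bilinear_def)
  have b2: "b m (n \<oplus>\<^bsub>N\<^esub> n') = b m n \<oplus>\<^bsub>P\<^esub> b m n'"
    if "m \<in> carrier M" "n \<in> carrier N" "n' \<in> carrier N" for m n n'
    using b that by (simp add: bilinear_def)
  have b3: "b (c \<odot>\<^bsub>M\<^esub> m) n = c \<odot>\<^bsub>P\<^esub> b m n" "b m (c \<odot>\<^bsub>N\<^esub> n) = c \<odot>\<^bsub>P\<^esub> b m n"
    if "c \<in> carrier k" "m \<in> carrier M" "n \<in> carrier N" for c m n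
    using b that by (simp_all add: bilinear_def)
  have self: "x \<ominus>\<^bsub>P\<^esub> x = \<zero>\<^bsub>P\<^esub>" if "x \<in> carrier P" for x
    using that by (simp add: a_minus_def P.M.r_neg)
  have "f p = \<zero>\<^bsub>P\<^esub>" if "p \<in> tensor_relations k M N" for p
    using that unfolding tensor_relations_def Let_def
    by (auto simp: minus e f.add f.smult f_dirac b1 b2 b3 bc self)
  then have "tensor_relations k M N \<subseteq> ?K"
    using tensor_relations_closed[OF assms(1,2)] by blast
  \<comment> \<open>The tensor kernel is the least submodule containing the relations, so it lies in
    the kernel of \<open>f\<close>, and \<open>f\<close> factors through the quotient.\<close>
  then have "tensor_kernel k M N \<subseteq> ?K"
    unfolding tensor_kernel_def by (rule hull_minimal) (rule f.kernel_submodule)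
  then have "\<exists>g. linear_map k (tensor_product k M N) P g \<and>
      (\<forall>p \<in> carrier ?F. g (tensor_kernel k M N +>\<^bsub>?F\<^esub> p) = f p)"
    unfolding tensor_product_def
    by (intro quotient_module_lift f tensor_kernel_submodule assms(1,2)) auto
  then show ?thesis using e f_dirac by (auto simp: tensor_def)
qed


section \<open>The algebra of a category with finitely many objects\<close>

lemma (in abelian_monoid) finsum_swap:
  assumes "finite J" "\<And>i j. \<lbrakk> i \<in> I; j \<in> J \<rbrakk> \<Longrightarrow> f i j \<in> carrier G"
  shows "(\<Oplus> i \<in> I. \<Oplus> j \<in> J. f i j) = (\<Oplus> j \<in> J. \<Oplus> i \<in> I. f i j)"
  using assms
proof (induction J rule: finite_induct)
  case (insert j J)
  have "(\<Oplus> i \<in> I. \<Oplus> j \<in> insert j J. f i j) = (\<Oplus> i \<in> I. f i j \<oplus> (\<Oplus> j \<in> J. f i j))"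
    using insert by (intro finsum_cong') auto
  also have "\<dots> = (\<Oplus> i \<in> I. f i j) \<oplus> (\<Oplus> i \<in> I. \<Oplus> j \<in> J. f i j)"
    using insert by (intro finsum_addf) auto
  also have "\<dots> = (\<Oplus> j \<in> insert j J. \<Oplus> i \<in> I. f i j)"
    using insert by (subst finsum_insert) auto
  finally show ?case .
qed simp

lemma category_algebra_ext:
  assumes "f \<in> carrier (category_algebra D)" and "g \<in> carrier (category_algebra D)"
    and "\<And>y x. \<lbrakk> y \<in> Obj D; x \<in> Obj D \<rbrakk> \<Longrightarrow> f (y, x) = g (y, x)"
  shows "f = g"
  using assms
  by (intro PiE_ext[of f "Obj D \<times> Obj D" "\<lambda>(y, x). carrier (Hom D y x)" g])
    (auto simp: category_algebra_def)

lemma category_algebra_entry: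
  assumes "y \<in> Obj D" "x \<in> Obj D"
  shows "f \<in> carrier (category_algebra D) \<Longrightarrow> f (y, x) \<in> carrier (Hom D y x)"
    and "(f \<otimes>\<^bsub>category_algebra D\<^esub> g) (y, x) =
      (\<Oplus>\<^bsub>Hom D y x\<^esub> z \<in> Obj D. Comp D y z x (f (y, z)) (g (z, x)))"
    and "\<one>\<^bsub>category_algebra D\<^esub> (y, x) = (if y = x then Ident D x else \<zero>\<^bsub>Hom D y x\<^esub>)"
    and "(f \<oplus>\<^bsub>category_algebra D\<^esub> g) (y, x) = f (y, x) \<oplus>\<^bsub>Hom D y x\<^esub> g (y, x)"
    and "(c \<odot>\<^bsub>category_algebra D\<^esub> f) (y, x) = c \<odot>\<^bsub>Hom D y x\<^esub> f (y, x)"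
  using assms by (auto simp: category_algebra_def PiE_iff)

context category_over
begin

lemma category_algebra_module: "module k (category_algebra C)"
proof -
  have "module k (Hom C (fst i) (snd i))" if "i \<in> Obj C \<times> Obj C" for i
    using that by (auto intro: hom_module)
  from module_PiE[OF is_cring this] show ?thesis
    by (simp add: category_algebra_def case_prod_unfold)
qed

lemma category_algebra_entry_linear:
  assumes "y \<in> Obj C" "x \<in> Obj C"
  shows "linear_map k (category_algebra C) (Hom C y x) (\<lambda>f. f (y, x))"
  using assms category_algebra_module
  by (simp add: linear_map_def linear_map_axioms_def hom_module category_algebra_entry)

text \<open>The argument for matrix rings, with composition in place of multiplication. Being linear
  in each argument, composition commutes with the inner sums of an iterated product; finiteness of
  \<open>Obj C\<close> makes the exchange of sums and the identity matrix work.\<close>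

lemma category_algebra_k_algebra:
  assumes fin: "finite (Obj C)"
  shows "k_algebra k (category_algebra C)"
proof -
  let ?S = "category_algebra C"
  interpret S: module k ?S by (rule category_algebra_module)
  note entry = category_algebra_entry[of _ C]
  have comp: "Comp C z y x g f \<in> carrier (Hom C z x)"
    if "x \<in> Obj C" "y \<in> Obj C" "z \<in> Obj C" "g \<in> carrier (Hom C z y)" "f \<in> carrier (Hom C y x)"
    for x y z g f
    using comp_bilinear[OF that(1-3)] that by (simp add: bilinear_def)
  have left: "linear_map k (Hom C z y) (Hom C z x) (\<lambda>g. Comp C z y x g f)"
    if "x \<in> Obj C" "y \<in> Obj C" "z \<in> Obj C" "f \<in> carrier (Hom C y x)" for x y z f
    by (rule bilinear_linear_left[OF _ _ comp_bilinear]) (use that hom_module in auto)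
  have right: "linear_map k (Hom C y x) (Hom C z x) (Comp C z y x g)"
    if "x \<in> Obj C" "y \<in> Obj C" "z \<in> Obj C" "g \<in> carrier (Hom C z y)" for x y z g
    by (rule bilinear_linear_right[OF _ _ comp_bilinear]) (use that hom_module in auto)
  have ag: "abelian_group (Hom C y x)" if "x \<in> Obj C" "y \<in> Obj C" for x y
    using hom_module[OF that] by (simp add: module_def)
  have am: "abelian_monoid (Hom C y x)" if "x \<in> Obj C" "y \<in> Obj C" for x y
    using ag[OF that] by (simp add: abelian_group_def)
  note sum_closed = abelian_monoid.finsum_closed[OF am]
  have mult_closed: "g \<otimes>\<^bsub>?S\<^esub> f \<in> carrier ?S" if "g \<in> carrier ?S" "f \<in> carrier ?S" for g f
  proof -
    have "(\<Oplus>\<^bsub>Hom C z x\<^esub> y \<in> Obj C. Comp C z y x (g (z, y)) (f (y, x))) \<in> carrier (Hom C z x)"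
      if "z \<in> Obj C" "x \<in> Obj C" for z x
      using that \<open>g \<in> carrier ?S\<close> \<open>f \<in> carrier ?S\<close>
      by (intro sum_closed) (auto simp: comp entry(1))
    then show ?thesis by (auto simp: category_algebra_def)
  qed
  have one_closed: "\<one>\<^bsub>?S\<^esub> \<in> carrier ?S"
    using ident_closed abelian_monoid.zero_closed[OF am] by (auto simp: category_algebra_def)
  have assoc: "(h \<otimes>\<^bsub>?S\<^esub> g) \<otimes>\<^bsub>?S\<^esub> f = h \<otimes>\<^bsub>?S\<^esub> (g \<otimes>\<^bsub>?S\<^esub> f)"
    if h: "h \<in> carrier ?S" and g: "g \<in> carrier ?S" and f: "f \<in> carrier ?S" for h g f
  proof (rule category_algebra_ext)
    fix w x assume w: "w \<in> Obj C" and x: "x \<in> Obj C"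
    interpret H: module k "Hom C w x" by (rule hom_module) fact+
    have "((h \<otimes>\<^bsub>?S\<^esub> g) \<otimes>\<^bsub>?S\<^esub> f) (w, x) = (\<Oplus>\<^bsub>Hom C w x\<^esub> y \<in> Obj C. Comp C w y x
        (\<Oplus>\<^bsub>Hom C w y\<^esub> z \<in> Obj C. Comp C w z y (h (w, z)) (g (z, y))) (f (y, x)))"
      using w x h g f
      by (subst entry(2), simp, simp, intro H.M.finsum_cong')
        (auto simp: entry intro!: comp sum_closed)
    also have "\<dots> = (\<Oplus>\<^bsub>Hom C w x\<^esub> y \<in> Obj C. \<Oplus>\<^bsub>Hom C w x\<^esub> z \<in> Obj C.
        Comp C w z x (h (w, z)) (Comp C z y x (g (z, y)) (f (y, x))))"
    proof (intro H.M.finsum_cong')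
      fix y assume y: "y \<in> Obj C"
      have "Comp C w y x (\<Oplus>\<^bsub>Hom C w y\<^esub> z \<in> Obj C. Comp C w z y (h (w, z)) (g (z, y))) (f (y, x)) =
          (\<Oplus>\<^bsub>Hom C w x\<^esub> z \<in> Obj C. Comp C w y x (Comp C w z y (h (w, z)) (g (z, y))) (f (y, x)))"
        using w x y h g f
        by (intro linear_map.finsum[OF left]) (auto simp: comp entry(1))
      also have "\<dots> = (\<Oplus>\<^bsub>Hom C w x\<^esub> z \<in> Obj C.
          Comp C w z x (h (w, z)) (Comp C z y x (g (z, y)) (f (y, x))))"
        using w x y h g f
        by (intro H.M.finsum_cong') (auto simp: comp_assoc comp entry(1))
      finally show "Comp C w y x (\<Oplus>\<^bsub>Hom C w y\<^esub> z \<in> Obj C. Comp C w z y (h (w, z)) (g (z, y)))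
          (f (y, x)) = (\<Oplus>\<^bsub>Hom C w x\<^esub> z \<in> Obj C.
          Comp C w z x (h (w, z)) (Comp C z y x (g (z, y)) (f (y, x))))" .
    qed (use w x h g f in \<open>auto simp: entry(1) intro!: comp sum_closed\<close>)
    \<comment> \<open>Associativity of \<open>Comp\<close> has made the summands of both bracketings
      equal; only the order of summation over \<open>y\<close> and \<open>z\<close> still
      differs.\<close>
    also have "\<dots> = (\<Oplus>\<^bsub>Hom C w x\<^esub> z \<in> Obj C. \<Oplus>\<^bsub>Hom C w x\<^esub> y \<in> Obj C.
        Comp C w z x (h (w, z)) (Comp C z y x (g (z, y)) (f (y, x))))"
      using w x h g f by (intro H.M.finsum_swap fin) (auto simp: comp entry(1))
    also have "\<dots> = (\<Oplus>\<^bsub>Hom C w x\<^esub> z \<in> Obj C. Comp C w z x (h (w, z))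
        (\<Oplus>\<^bsub>Hom C z x\<^esub> y \<in> Obj C. Comp C z y x (g (z, y)) (f (y, x))))"
      using w x h g f
      by (intro H.M.finsum_cong' linear_map.finsum[OF right, symmetric])
        (auto simp: entry(1) intro!: comp sum_closed)
    also have "\<dots> = (h \<otimes>\<^bsub>?S\<^esub> (g \<otimes>\<^bsub>?S\<^esub> f)) (w, x)"
      using w x h g f
      by (subst entry(2), simp, simp, intro H.M.finsum_cong')
        (auto simp: entry intro!: comp sum_closed)
    finally show "((h \<otimes>\<^bsub>?S\<^esub> g) \<otimes>\<^bsub>?S\<^esub> f) (w, x) = (h \<otimes>\<^bsub>?S\<^esub> (g \<otimes>\<^bsub>?S\<^esub> f)) (w, x)" .
  qed (intro mult_closed that)+
  have l_one: "\<one>\<^bsub>?S\<^esub> \<otimes>\<^bsub>?S\<^esub> f = f" if f: "f \<in> carrier ?S" for f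
  proof (rule category_algebra_ext)
    fix z x assume z: "z \<in> Obj C" and x: "x \<in> Obj C"
    interpret H: module k "Hom C z x" by (rule hom_module) fact+
    have "(\<one>\<^bsub>?S\<^esub> \<otimes>\<^bsub>?S\<^esub> f) (z, x) =
        (\<Oplus>\<^bsub>Hom C z x\<^esub> y \<in> Obj C. if z = y then f (z, x) else \<zero>\<^bsub>Hom C z x\<^esub>)"
      unfolding entry(2)[OF z x] using z x f
      by (intro H.M.finsum_cong')
        (auto simp: entry(3) ident_left linear_map.zero[OF left] entry(1))
    also have "\<dots> = f (z, x)"
      using z x f fin
      by (subst H.M.finsum_singleton) (auto simp: entry(1))
    finally show "(\<one>\<^bsub>?S\<^esub> \<otimes>\<^bsub>?S\<^esub> f) (z, x) = f (z, x)" .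
  qed (intro mult_closed one_closed f)+
  have r_one: "f \<otimes>\<^bsub>?S\<^esub> \<one>\<^bsub>?S\<^esub> = f" if f: "f \<in> carrier ?S" for f
  proof (rule category_algebra_ext)
    fix z x assume z: "z \<in> Obj C" and x: "x \<in> Obj C"
    interpret H: module k "Hom C z x" by (rule hom_module) fact+
    have "(f \<otimes>\<^bsub>?S\<^esub> \<one>\<^bsub>?S\<^esub>) (z, x) =
        (\<Oplus>\<^bsub>Hom C z x\<^esub> y \<in> Obj C. if x = y then f (z, x) else \<zero>\<^bsub>Hom C z x\<^esub>)"
      unfolding entry(2)[OF z x] using z x f
      by (intro H.M.finsum_cong')
        (auto simp: entry(3) ident_right linear_map.zero[OF right] entry(1))
    also have "\<dots> = f (z, x)"
      using z x f fin
      by (subst H.M.finsum_singleton) (auto simp: entry(1))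
    finally show "(f \<otimes>\<^bsub>?S\<^esub> \<one>\<^bsub>?S\<^esub>) (z, x) = f (z, x)" .
  qed (intro mult_closed one_closed f)+
  have left_linear: "linear_map k ?S ?S (\<lambda>g. g \<otimes>\<^bsub>?S\<^esub> f)" if f: "f \<in> carrier ?S" for f
  proof
    fix g assume g: "g \<in> carrier ?S"
    { fix h assume h: "h \<in> carrier ?S"
      show "(g \<oplus>\<^bsub>?S\<^esub> h) \<otimes>\<^bsub>?S\<^esub> f = g \<otimes>\<^bsub>?S\<^esub> f \<oplus>\<^bsub>?S\<^esub> h \<otimes>\<^bsub>?S\<^esub> f"
      proof (rule category_algebra_ext)
        fix z x assume z: "z \<in> Obj C" and x: "x \<in> Obj C"
        interpret H: module k "Hom C z x" by (rule hom_module) fact+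
        show "((g \<oplus>\<^bsub>?S\<^esub> h) \<otimes>\<^bsub>?S\<^esub> f) (z, x) = (g \<otimes>\<^bsub>?S\<^esub> f \<oplus>\<^bsub>?S\<^esub> h \<otimes>\<^bsub>?S\<^esub> f) (z, x)"
          unfolding entry(2)[OF z x] entry(4)[OF z x] using z x f g h
          by (subst H.M.finsum_addf[symmetric]; (intro H.M.finsum_cong')?)
            (auto simp: entry(4) linear_map.add[OF left] entry(1) comp)
      qed (intro mult_closed S.M.add.m_closed f g h)+ }
    { fix c assume c: "c \<in> carrier k"
      show "(c \<odot>\<^bsub>?S\<^esub> g) \<otimes>\<^bsub>?S\<^esub> f = c \<odot>\<^bsub>?S\<^esub> (g \<otimes>\<^bsub>?S\<^esub> f)"
      proof (rule category_algebra_ext)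
        fix z x assume z: "z \<in> Obj C" and x: "x \<in> Obj C"
        interpret H: module k "Hom C z x" by (rule hom_module) fact+
        show "((c \<odot>\<^bsub>?S\<^esub> g) \<otimes>\<^bsub>?S\<^esub> f) (z, x) = (c \<odot>\<^bsub>?S\<^esub> (g \<otimes>\<^bsub>?S\<^esub> f)) (z, x)"
          unfolding entry(2)[OF z x] entry(5)[OF z x] using z x f g c fin
          by (subst H.finsum_smult_ldistr; (intro H.M.finsum_cong')?)
            (auto simp: entry(5) linear_map.smult[OF left] entry(1) comp)
      qed (intro mult_closed S.smult_closed f g c)+ }
  qed (intro mult_closed f)
  have right_linear: "linear_map k ?S ?S (\<lambda>g. f \<otimes>\<^bsub>?S\<^esub> g)" if f: "f \<in> carrier ?S" for f
  proof
    fix g assume g: "g \<in> carrier ?S"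
    { fix h assume h: "h \<in> carrier ?S"
      show "f \<otimes>\<^bsub>?S\<^esub> (g \<oplus>\<^bsub>?S\<^esub> h) = f \<otimes>\<^bsub>?S\<^esub> g \<oplus>\<^bsub>?S\<^esub> f \<otimes>\<^bsub>?S\<^esub> h"
      proof (rule category_algebra_ext)
        fix z x assume z: "z \<in> Obj C" and x: "x \<in> Obj C"
        interpret H: module k "Hom C z x" by (rule hom_module) fact+
        show "(f \<otimes>\<^bsub>?S\<^esub> (g \<oplus>\<^bsub>?S\<^esub> h)) (z, x) = (f \<otimes>\<^bsub>?S\<^esub> g \<oplus>\<^bsub>?S\<^esub> f \<otimes>\<^bsub>?S\<^esub> h) (z, x)"
          unfolding entry(2)[OF z x] entry(4)[OF z x] using z x f g h
          by (subst H.M.finsum_addf[symmetric]; (intro H.M.finsum_cong')?)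
            (auto simp: entry(4) linear_map.add[OF right] entry(1) comp)
      qed (intro mult_closed S.M.add.m_closed f g h)+ }
    { fix c assume c: "c \<in> carrier k"
      show "f \<otimes>\<^bsub>?S\<^esub> (c \<odot>\<^bsub>?S\<^esub> g) = c \<odot>\<^bsub>?S\<^esub> (f \<otimes>\<^bsub>?S\<^esub> g)"
      proof (rule category_algebra_ext)
        fix z x assume z: "z \<in> Obj C" and x: "x \<in> Obj C"
        interpret H: module k "Hom C z x" by (rule hom_module) fact+
        show "(f \<otimes>\<^bsub>?S\<^esub> (c \<odot>\<^bsub>?S\<^esub> g)) (z, x) = (c \<odot>\<^bsub>?S\<^esub> (f \<otimes>\<^bsub>?S\<^esub> g)) (z, x)"
          unfolding entry(2)[OF z x] entry(5)[OF z x] using z x f g c fin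
          by (subst H.finsum_smult_ldistr; (intro H.M.finsum_cong')?)
            (auto simp: entry(5) linear_map.smult[OF right] entry(1) comp)
      qed (intro mult_closed S.smult_closed f g c)+ }
  qed (intro mult_closed f)
  have "ring ?S"
    by (intro ringI S.M.abelian_group_axioms monoidI)
      (auto simp: assoc l_one r_one linear_map.add[OF left_linear] linear_map.add[OF right_linear]
        intro: mult_closed one_closed)
  then show ?thesis
    using linear_map.smult[OF left_linear] linear_map.smult[OF right_linear]
    by (intro k_algebra.intro k_algebra_axioms.intro S.module_axioms) auto
qed

end


section \<open>Smash product categories\<close>

text \<open>Degrees telescope: (u^-1 t)(t^-1 s) = u^-1 s, so composition of \<open>B\<close>
  restricts to the homogeneous pieces, and identities have degree s^-1 s = 1. The operations are
  those of \<open>B\<close> on submodules, so all laws are inherited.\<close>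

lemma (in graded_category) smash_category_over: "category_over k (smash_category G B gr)"
proof -
  let ?S = "smash_category G B gr"
  have sub: "submodule (gr y x s) k (Hom B y x)"
    if "x \<in> Obj B" "y \<in> Obj B" "s \<in> carrier G" for x y s
    using hom_decomposition[OF that(1,2)] that(3) by (simp add: direct_sum_decomposition_def)
  have incl: "f \<in> carrier (Hom B y x)"
    if "f \<in> gr y x s" "x \<in> Obj B" "y \<in> Obj B" "s \<in> carrier G" for f x y s
    using module.submoduleE(1)[OF hom_module sub] that by blast
  have inv_mult: "inv\<^bsub>G\<^esub> u \<otimes>\<^bsub>G\<^esub> t \<otimes>\<^bsub>G\<^esub> (inv\<^bsub>G\<^esub> t \<otimes>\<^bsub>G\<^esub> s) = inv\<^bsub>G\<^esub> u \<otimes>\<^bsub>G\<^esub> s"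
    if "s \<in> carrier G" "t \<in> carrier G" "u \<in> carrier G" for s t u
  proof -
    have "t \<otimes>\<^bsub>G\<^esub> (inv\<^bsub>G\<^esub> t \<otimes>\<^bsub>G\<^esub> s) = s" using that by (simp add: m_assoc[symmetric])
    then show ?thesis using that by (simp add: m_assoc)
  qed
  have comp: "Comp B z y x g f \<in> gr z x (inv\<^bsub>G\<^esub> u \<otimes>\<^bsub>G\<^esub> s)"
    if "x \<in> Obj B" "y \<in> Obj B" "z \<in> Obj B" "s \<in> carrier G" "t \<in> carrier G" "u \<in> carrier G"
      "g \<in> gr z y (inv\<^bsub>G\<^esub> u \<otimes>\<^bsub>G\<^esub> t)" "f \<in> gr y x (inv\<^bsub>G\<^esub> t \<otimes>\<^bsub>G\<^esub> s)" for x y z s t u g f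
    using comp_homogeneous[OF that(1-3) _ _ that(7,8)] that by (simp add: inv_mult)
  show ?thesis
  proof (intro category_over.intro category_over_axioms.intro is_cring)
    fix x y assume "x \<in> Obj ?S" "y \<in> Obj ?S"
    then show "module k (Hom ?S y x)"
      by (auto simp: smash_category_def intro!: submodule.submodule_is_module sub hom_module)
  next
    fix x y z assume "x \<in> Obj ?S" "y \<in> Obj ?S" "z \<in> Obj ?S"
    then obtain a s b t c u where obj: "x = (a, s)" "y = (b, t)" "z = (c, u)"
      "a \<in> Obj B" "b \<in> Obj B" "c \<in> Obj B" "s \<in> carrier G" "t \<in> carrier G" "u \<in> carrier G"
      by (auto simp: smash_category_def)
    then show "bilinear k (Hom ?S z y) (Hom ?S y x) (Hom ?S z x) (Comp ?S z y x)"
      using comp_bilinear[OF obj(4-6)] comp[OF obj(4-9)] incl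
      by (simp add: smash_category_def bilinear_def)
  next
    fix x y z w f g h
    assume "x \<in> Obj ?S" "y \<in> Obj ?S" "z \<in> Obj ?S" "w \<in> Obj ?S"
      "f \<in> carrier (Hom ?S y x)" "g \<in> carrier (Hom ?S z y)" "h \<in> carrier (Hom ?S w z)"
    then show "Comp ?S w y x (Comp ?S w z y h g) f = Comp ?S w z x h (Comp ?S z y x g f)"
      by (auto simp: smash_category_def intro!: comp_assoc intro: incl)
  next
    fix x assume "x \<in> Obj ?S"
    then show "Ident ?S x \<in> carrier (Hom ?S x x)"
      by (auto simp: smash_category_def intro: ident_homogeneous)
  next
    fix x y f assume "x \<in> Obj ?S" "y \<in> Obj ?S" "f \<in> carrier (Hom ?S y x)"
    then show "Comp ?S y y x (Ident ?S y) f = f" "Comp ?S y x x f (Ident ?S x) = f"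
      by (auto simp: smash_category_def intro!: ident_left ident_right intro: incl)
  qed
qed

lemma single_object_graded_category:
  fixes A :: "('k, 'a) module"
  assumes "graded_algebra k G A gr"
  shows "graded_category k G (single_object_category A) (\<lambda>_ _. gr)"
proof -
  interpret graded_algebra k G A gr by fact
  have "monoid A" by (rule ring.is_monoid) (rule k_algebra.axioms(2)[OF k_algebra_axioms])
  note A_monoid = monoid.m_assoc[OF this] monoid.m_closed[OF this] monoid.one_closed[OF this]
    monoid.l_one[OF this] monoid.r_one[OF this]
  have "bilinear k A A A (mult A)"
    by (simp add: bilinear_def l_distr r_distr smult_mult_l smult_mult_r)
  then show ?thesis
    by (intro graded_category.intro graded_category_axioms.intro category_over.intro
        category_over_axioms.intro R.is_cring group_axioms)
      (simp_all add: single_object_category_def module_axioms A_monoid decomposition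
        mult_homogeneous one_homogeneous)
qed


section \<open>Homogeneous components\<close>

locale finite_graded_algebra = graded_algebra k G A gr
  for k :: "('k, 'r) ring_scheme" and G :: "('g, 's) monoid_scheme"
    and A :: "('k, 'a) module" and gr :: "'g \<Rightarrow> 'a set" +
  assumes finite_group: "finite (carrier G)"
begin

text \<open>\<open>direct_sum_decomposition\<close> sums over the support of a family. As
  \<open>G\<close> is finite, the sum over all of \<open>G\<close> has the same value
  (\<open>ex1_decomposition\<close>), and its index set does not depend on \<open>a\<close>.\<close>

definition component :: "'g \<Rightarrow> 'a \<Rightarrow> 'a"
  where "component s a =
    (THE c. c \<in> (\<Pi>\<^sub>E s \<in> carrier G. gr s) \<and> a = (\<Oplus>\<^bsub>A\<^esub> s \<in> carrier G. c s)) s"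

lemma gr_submodule: "s \<in> carrier G \<Longrightarrow> submodule (gr s) k A"
  using decomposition by (simp add: direct_sum_decomposition_def)

lemma gr_carrier: "a \<in> gr s \<Longrightarrow> s \<in> carrier G \<Longrightarrow> a \<in> carrier A"
  using submoduleE(1)[OF gr_submodule] by blast

lemma zero_gr: "s \<in> carrier G \<Longrightarrow> \<zero>\<^bsub>A\<^esub> \<in> gr s"
  using subgroup.one_closed[OF submodule.axioms(1)[OF gr_submodule]] by simp

lemma ex1_decomposition:
  assumes "a \<in> carrier A"
  shows "\<exists>!c. c \<in> (\<Pi>\<^sub>E s \<in> carrier G. gr s) \<and> a = (\<Oplus>\<^bsub>A\<^esub> s \<in> carrier G. c s)"
proof -
  have "(\<Oplus>\<^bsub>A\<^esub> s \<in> {s \<in> carrier G. c s \<noteq> \<zero>\<^bsub>A\<^esub>}. c s) = (\<Oplus>\<^bsub>A\<^esub> s \<in> carrier G. c s)"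
    if "c \<in> (\<Pi>\<^sub>E s \<in> carrier G. gr s)" for c
    using that gr_carrier
    by (intro M.add.finprod_mono_neutral_cong_left finite_group) (auto simp: PiE_iff)
  moreover have "\<exists>!c. c \<in> (\<Pi>\<^sub>E s \<in> carrier G. gr s) \<and> finite {s \<in> carrier G. c s \<noteq> \<zero>\<^bsub>A\<^esub>} \<and>
      a = (\<Oplus>\<^bsub>A\<^esub> s \<in> {s \<in> carrier G. c s \<noteq> \<zero>\<^bsub>A\<^esub>}. c s)"
    using decomposition assms by (simp add: direct_sum_decomposition_def)
  ultimately show ?thesis using finite_group by (simp cong: conj_cong)
qed

lemma component_gr: "\<lbrakk> a \<in> carrier A; s \<in> carrier G \<rbrakk> \<Longrightarrow> component s a \<in> gr s"
  using theI'[OF ex1_decomposition, of a] by (simp add: component_def PiE_iff)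

lemma component_closed: "\<lbrakk> a \<in> carrier A; s \<in> carrier G \<rbrakk> \<Longrightarrow> component s a \<in> carrier A"
  using component_gr gr_carrier by blast

lemma sum_component: "a \<in> carrier A \<Longrightarrow> (\<Oplus>\<^bsub>A\<^esub> s \<in> carrier G. component s a) = a"
  using theI'[OF ex1_decomposition, of a] by (simp add: component_def)

lemma component_eqI:
  assumes c: "\<And>s. s \<in> carrier G \<Longrightarrow> c s \<in> gr s" and a: "a = (\<Oplus>\<^bsub>A\<^esub> s \<in> carrier G. c s)"
    and s: "s \<in> carrier G"
  shows "component s a = c s"
proof -
  have cA: "c \<in> carrier G \<rightarrow> carrier A" using c gr_carrier by blast
  then have "a \<in> carrier A" unfolding a by (rule M.finsum_closed)
  \<comment> \<open>Uniqueness of decompositions concerns extensional families, so \<open>c\<close>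
    is first cut off to \<open>carrier G\<close>.\<close>
  moreover have "a = (\<Oplus>\<^bsub>A\<^esub> s \<in> carrier G. restrict c (carrier G) s)"
    unfolding a using cA by (intro M.finsum_cong') auto
  ultimately have "(THE c. c \<in> (\<Pi>\<^sub>E s \<in> carrier G. gr s) \<and> a = (\<Oplus>\<^bsub>A\<^esub> s \<in> carrier G. c s)) =
      restrict c (carrier G)"
    using c by (intro the1_equality ex1_decomposition) auto
  then show ?thesis using s by (simp add: component_def)
qed

lemma component_linear:
  assumes s: "s \<in> carrier G"
  shows "linear_map k A A (component s)"
proof
  fix a assume a: "a \<in> carrier A"
  show "component s a \<in> carrier A" using a s by (rule component_closed)
  { fix b assume b: "b \<in> carrier A"
    show "component s (a \<oplus>\<^bsub>A\<^esub> b) = component s a \<oplus>\<^bsub>A\<^esub> component s b"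
    proof (rule component_eqI)
      have "(\<Oplus>\<^bsub>A\<^esub> s \<in> carrier G. component s a \<oplus>\<^bsub>A\<^esub> component s b) =
          (\<Oplus>\<^bsub>A\<^esub> s \<in> carrier G. component s a) \<oplus>\<^bsub>A\<^esub> (\<Oplus>\<^bsub>A\<^esub> s \<in> carrier G. component s b)"
        using a b component_closed by (intro M.finsum_addf) auto
      then show "a \<oplus>\<^bsub>A\<^esub> b = (\<Oplus>\<^bsub>A\<^esub> s \<in> carrier G. component s a \<oplus>\<^bsub>A\<^esub> component s b)"
        using a b by (simp add: sum_component)
    qed (use a b s in \<open>auto intro: submoduleE(5)[OF gr_submodule] component_gr\<close>) }
  { fix c assume c: "c \<in> carrier k"
    show "component s (c \<odot>\<^bsub>A\<^esub> a) = c \<odot>\<^bsub>A\<^esub> component s a"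
    proof (rule component_eqI)
      have "c \<odot>\<^bsub>A\<^esub> (\<Oplus>\<^bsub>A\<^esub> s \<in> carrier G. component s a) = (\<Oplus>\<^bsub>A\<^esub> s \<in> carrier G. c \<odot>\<^bsub>A\<^esub> component s a)"
        using a c component_closed by (intro finsum_smult_ldistr finite_group) auto
      then show "c \<odot>\<^bsub>A\<^esub> a = (\<Oplus>\<^bsub>A\<^esub> s \<in> carrier G. c \<odot>\<^bsub>A\<^esub> component s a)"
        using a by (simp add: sum_component)
    qed (use a c s in \<open>auto intro: submoduleE(4)[OF gr_submodule] component_gr\<close>) }
qed

lemma component_homogeneous:
  assumes "a \<in> gr s" and "s \<in> carrier G" and "t \<in> carrier G"
  shows "component t a = (if s = t then a else \<zero>\<^bsub>A\<^esub>)"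
proof (rule component_eqI)
  have "(\<Oplus>\<^bsub>A\<^esub> t \<in> carrier G. if s = t then a else \<zero>\<^bsub>A\<^esub>) = a"
    using assms gr_carrier by (intro M.finsum_singleton finite_group) auto
  then show "a = (\<Oplus>\<^bsub>A\<^esub> t \<in> carrier G. if s = t then a else \<zero>\<^bsub>A\<^esub>)" by (rule sym)
qed (use assms zero_gr in auto)

text \<open>Right multiplication by an element of degree \<open>s\<close> moves degree
  \<open>t\<close> to degree \<open>t s\<close>, so the family \<open>c\<close> below is a
  homogeneous decomposition of the product and uniqueness applies. The left factor stays arbitrary,
  as in the commutation rule of the smash product.\<close>

lemma component_mult:
  assumes a: "a \<in> carrier A" and b: "b \<in> gr s" and s: "s \<in> carrier G" and t: "t \<in> carrier G"
  shows "component (t \<otimes>\<^bsub>G\<^esub> s) (a \<otimes>\<^bsub>A\<^esub> b) = component t a \<otimes>\<^bsub>A\<^esub> b"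
proof -
  have bA: "b \<in> carrier A" using b s by (rule gr_carrier)
  define c where "c r = component (r \<otimes>\<^bsub>G\<^esub> inv\<^bsub>G\<^esub> s) a \<otimes>\<^bsub>A\<^esub> b" for r
  have cancel: "r \<otimes>\<^bsub>G\<^esub> inv\<^bsub>G\<^esub> s \<otimes>\<^bsub>G\<^esub> s = r" "r \<otimes>\<^bsub>G\<^esub> s \<otimes>\<^bsub>G\<^esub> inv\<^bsub>G\<^esub> s = r" if "r \<in> carrier G" for r
    using that s by (simp_all add: m_assoc)
  have c: "c r \<in> gr r" if r: "r \<in> carrier G" for r
    using mult_homogeneous[of "r \<otimes>\<^bsub>G\<^esub> inv\<^bsub>G\<^esub> s" s "component (r \<otimes>\<^bsub>G\<^esub> inv\<^bsub>G\<^esub> s) a" b] r s a b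
    by (simp add: c_def component_gr cancel)
  have "a \<otimes>\<^bsub>A\<^esub> b = (\<Oplus>\<^bsub>A\<^esub> t \<in> carrier G. component t a) \<otimes>\<^bsub>A\<^esub> b"
    using a by (simp add: sum_component)
  also have "\<dots> = (\<Oplus>\<^bsub>A\<^esub> t \<in> carrier G. component t a \<otimes>\<^bsub>A\<^esub> b)"
    using a bA component_closed by (intro finsum_ldistr finite_group) auto
  also have "\<dots> = (\<Oplus>\<^bsub>A\<^esub> t \<in> carrier G. c (t \<otimes>\<^bsub>G\<^esub> s))"
    using a bA s component_closed by (intro M.finsum_cong') (auto simp: c_def cancel)
  also have "\<dots> = (\<Oplus>\<^bsub>A\<^esub> r \<in> (\<lambda>t. t \<otimes>\<^bsub>G\<^esub> s) ` carrier G. c r)"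
    using s c gr_carrier by (intro M.finsum_reindex[symmetric]) (auto intro: inj_onI)
  also have "(\<lambda>t. t \<otimes>\<^bsub>G\<^esub> s) ` carrier G = carrier G"
  proof (intro equalityI subsetI)
    fix r assume r: "r \<in> carrier G"
    then show "r \<in> (\<lambda>t. t \<otimes>\<^bsub>G\<^esub> s) ` carrier G"
      using s by (intro image_eqI[of _ _ "r \<otimes>\<^bsub>G\<^esub> inv\<^bsub>G\<^esub> s"]) (simp_all add: cancel)
  qed (use s in auto)
  finally have "component (t \<otimes>\<^bsub>G\<^esub> s) (a \<otimes>\<^bsub>A\<^esub> b) = c (t \<otimes>\<^bsub>G\<^esub> s)"
    using c s t by (intro component_eqI) auto
  then show ?thesis using t by (simp add: c_def cancel)
qed

end


section \<open>The isomorphism\<close>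

context finite_graded_algebra
begin

section \<open>Notation and spanning sets of the tensor product\<close>

abbreviation kG where "kG \<equiv> function_algebra k (carrier G)"
abbreviation \<delta> where "\<delta> \<equiv> dirac k (carrier G)"
abbreviation T where "T \<equiv> tensor_product k A kG"
abbreviation tens where "tens \<equiv> tensor k A kG"
abbreviation D where "D \<equiv> smash_category G (single_object_category A) (\<lambda>_ _. gr)"
abbreviation C where "C \<equiv> category_algebra D"

lemma kG_module: "module k kG"
  by (rule function_algebra_module) (rule R.is_cring)

lemma T_module: "module k T"
  by (intro tensor_product_module module_axioms kG_module)

lemma carrier_kG: "carrier kG = carrier G \<rightarrow>\<^sub>E carrier k"
  by (simp add: function_algebra_def)

lemma dirac_kG: "\<delta> s \<in> carrier kG"
  unfolding carrier_kG by (rule dirac_closed) (rule R.is_cring)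

lemmas tens_bilinear = tensor_bilinear[OF module_axioms kG_module]

lemma tens_closed: "\<lbrakk> a \<in> carrier A; p \<in> carrier kG \<rbrakk> \<Longrightarrow> tens a p \<in> carrier T"
  using tens_bilinear by (simp add: bilinear_def)

lemmas tens_linear_left = bilinear_linear_left[OF module_axioms T_module tens_bilinear]
lemmas tens_linear_right = bilinear_linear_right[OF kG_module T_module tens_bilinear]

lemma tens_smult_swap:
  "\<lbrakk> c \<in> carrier k; a \<in> carrier A; p \<in> carrier kG \<rbrakk> \<Longrightarrow> tens (c \<odot>\<^bsub>A\<^esub> a) p = tens a (c \<odot>\<^bsub>kG\<^esub> p)"
  using tens_bilinear by (simp add: bilinear_def)

text \<open>For finite \<open>G\<close> a function \<open>p\<close> is the combination of Dirac
  masses with coefficients \<open>p t\<close>, and these scalars can be moved into the left tensor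
  factor.\<close>

lemma T_spanned_dirac:
  assumes H: "submodule H k T"
    and gen: "\<And>a t. \<lbrakk> a \<in> carrier A; t \<in> carrier G \<rbrakk> \<Longrightarrow> tens a (\<delta> t) \<in> H"
  shows "carrier T \<subseteq> H"
proof (rule tensor_product_spanned[OF module_axioms kG_module H])
  fix a p assume a: "a \<in> carrier A" and p: "p \<in> carrier kG"
  interpret kG: module k kG by (rule kG_module)
  have pk: "p t \<in> carrier k" if "t \<in> carrier G" for t using p that by (auto simp: carrier_kG)
  have "tens a p = tens a (\<Oplus>\<^bsub>kG\<^esub> t \<in> carrier G. p t \<odot>\<^bsub>kG\<^esub> \<delta> t)"
    using finsum_dirac[OF R.is_cring finite_group, of p] p by (simp add: carrier_kG)
  also have "\<dots> = (\<Oplus>\<^bsub>T\<^esub> t \<in> carrier G. tens a (p t \<odot>\<^bsub>kG\<^esub> \<delta> t))"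
    using pk dirac_kG by (intro linear_map.finsum[OF tens_linear_right[OF a]]) auto
  also have "\<dots> \<in> H"
    using a pk dirac_kG gen
    by (intro submodule_finsum[OF T_module H]) (auto simp: tens_smult_swap[symmetric])
  finally show "tens a p \<in> H" .
qed

text \<open>Splitting \<open>a\<close> into components leaves exactly the tensors that the
  commutation rule allows as right argument.\<close>

lemma T_spanned:
  assumes H: "submodule H k T"
    and gen: "\<And>a s t. \<lbrakk> s \<in> carrier G; a \<in> gr s; t \<in> carrier G \<rbrakk> \<Longrightarrow> tens a (\<delta> t) \<in> H"
  shows "carrier T \<subseteq> H"
proof (rule T_spanned_dirac[OF H])
  fix a t assume a: "a \<in> carrier A" and t: "t \<in> carrier G"
  have "tens a (\<delta> t) = tens (\<Oplus>\<^bsub>A\<^esub> s \<in> carrier G. component s a) (\<delta> t)"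
    using a by (simp add: sum_component)
  also have "\<dots> = (\<Oplus>\<^bsub>T\<^esub> s \<in> carrier G. tens (component s a) (\<delta> t))"
    using a component_closed by (intro linear_map.finsum[OF tens_linear_left[OF dirac_kG]]) auto
  also have "\<dots> \<in> H"
    using a t gen component_gr by (intro submodule_finsum[OF T_module H]) auto
  finally show "tens a (\<delta> t) \<in> H" .
qed

section \<open>Matrices with homogeneous entries, indexed by the group\<close>

lemma Obj_D: "Obj D = {()} \<times> carrier G"
  by (simp add: smash_category_def single_object_category_def)

lemma Hom_D: "Hom D ((), t) ((), s) = A\<lparr>carrier := gr (inv\<^bsub>G\<^esub> t \<otimes>\<^bsub>G\<^esub> s)\<rparr>"
  by (simp add: smash_category_def single_object_category_def)

lemma D_category: "category_over k D"
  by (intro graded_category.smash_category_over single_object_graded_category graded_algebra_axioms)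

lemma C_k_algebra: "k_algebra k C"
  using finite_group by (intro category_over.category_algebra_k_algebra D_category) (simp add: Obj_D)

lemma C_module: "module k C"
  by (rule category_over.category_algebra_module[OF D_category])

lemma C_ext:
  assumes "f \<in> carrier C" "g \<in> carrier C"
    and "\<And>t s. \<lbrakk> t \<in> carrier G; s \<in> carrier G \<rbrakk> \<Longrightarrow> f (((), t), ((), s)) = g (((), t), ((), s))"
  shows "f = g"
  using assms by (intro category_algebra_ext[of f D g]) (auto simp: Obj_D)

text \<open>Each position has its own homogeneous piece as target. Composing with the inclusion
  makes \<open>A\<close> the common target, so that the entries of a column can be added.\<close>

lemma entry_linear:
  assumes "t \<in> carrier G" "s \<in> carrier G"
  shows "linear_map k C A (\<lambda>f. f (((), t), ((), s)))"
proof -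
  have "linear_map k C (A\<lparr>carrier := gr (inv\<^bsub>G\<^esub> t \<otimes>\<^bsub>G\<^esub> s)\<rparr>) (\<lambda>f. f (((), t), ((), s)))"
    using category_over.category_algebra_entry_linear[OF D_category, of "((), t)" "((), s)"] assms
    by (simp add: Obj_D Hom_D)
  then show ?thesis
    by (rule linear_map_compose)
      (use assms in \<open>intro submodule_inclusion_linear module_axioms gr_submodule, simp\<close>)
qed

lemma entry_gr:
  assumes "t \<in> carrier G" "s \<in> carrier G" "f \<in> carrier C"
  shows "f (((), t), ((), s)) \<in> gr (inv\<^bsub>G\<^esub> t \<otimes>\<^bsub>G\<^esub> s)"
  using category_algebra_entry(1)[of "((), t)" D "((), s)" f] assms by (simp add: Obj_D Hom_D)

text \<open>The category algebra forms this sum over objects \<open>((), r)\<close> and inside the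
  piece of degree t^-1 s. Reindexing and the inclusion into \<open>A\<close> turn it into the
  ordinary matrix product.\<close>

lemma entry_mult:
  assumes t: "t \<in> carrier G" and s: "s \<in> carrier G" and f: "f \<in> carrier C" and g: "g \<in> carrier C"
  shows "(f \<otimes>\<^bsub>C\<^esub> g) (((), t), ((), s)) =
    (\<Oplus>\<^bsub>A\<^esub> r \<in> carrier G. f (((), t), ((), r)) \<otimes>\<^bsub>A\<^esub> g (((), r), ((), s)))"
proof -
  let ?A = "A\<lparr>carrier := gr (inv\<^bsub>G\<^esub> t \<otimes>\<^bsub>G\<^esub> s)\<rparr>"
  let ?e = "\<lambda>z. f (((), t), z) \<otimes>\<^bsub>A\<^esub> g (z, ((), s))"
  have e: "?e ((), r) \<in> gr (inv\<^bsub>G\<^esub> t \<otimes>\<^bsub>G\<^esub> s)" if r: "r \<in> carrier G" for r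
  proof -
    have "r \<otimes>\<^bsub>G\<^esub> (inv\<^bsub>G\<^esub> r \<otimes>\<^bsub>G\<^esub> s) = s" using r s by (simp add: m_assoc[symmetric])
    then have "inv\<^bsub>G\<^esub> t \<otimes>\<^bsub>G\<^esub> r \<otimes>\<^bsub>G\<^esub> (inv\<^bsub>G\<^esub> r \<otimes>\<^bsub>G\<^esub> s) = inv\<^bsub>G\<^esub> t \<otimes>\<^bsub>G\<^esub> s"
      using r s t by (simp add: m_assoc)
    then show ?thesis
      using mult_homogeneous[OF _ _ entry_gr[OF t r f] entry_gr[OF r s g]] r s t by simp
  qed
  interpret i: linear_map k ?A A "\<lambda>x. x"
    using s t by (intro submodule_inclusion_linear module_axioms gr_submodule) simp
  have "Pair () ` carrier G = Obj D" by (auto simp: Obj_D)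
  then have "(f \<otimes>\<^bsub>C\<^esub> g) (((), t), ((), s)) = (\<Oplus>\<^bsub>?A\<^esub> z \<in> Pair () ` carrier G. ?e z)"
    using s t by (simp add: category_algebra_entry(2) Obj_D)
      (simp add: smash_category_def single_object_category_def case_prod_unfold)
  also have "\<dots> = (\<Oplus>\<^bsub>?A\<^esub> r \<in> carrier G. ?e ((), r))"
    using e by (intro i.dom.M.finsum_reindex) (auto intro: inj_onI)
  also have "\<dots> = (\<Oplus>\<^bsub>A\<^esub> r \<in> carrier G. ?e ((), r))"
    using e by (intro i.finsum) auto
  finally show ?thesis .
qed

section \<open>From tensors to matrices\<close>

definition tensor_matrix :: "'a \<Rightarrow> ('g \<Rightarrow> 'k) \<Rightarrow> ((unit \<times> 'g) \<times> (unit \<times> 'g) \<Rightarrow> 'a)"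
  where "tensor_matrix a p = (\<lambda>(y, x) \<in> Obj D \<times> Obj D.
    p (inv\<^bsub>G\<^esub> (snd x)) \<odot>\<^bsub>A\<^esub> component (inv\<^bsub>G\<^esub> (snd y) \<otimes>\<^bsub>G\<^esub> snd x) a)"

lemma entry_tensor_matrix:
  "\<lbrakk> t \<in> carrier G; s \<in> carrier G \<rbrakk> \<Longrightarrow> tensor_matrix a p (((), t), ((), s)) =
    p (inv\<^bsub>G\<^esub> s) \<odot>\<^bsub>A\<^esub> component (inv\<^bsub>G\<^esub> t \<otimes>\<^bsub>G\<^esub> s) a"
  by (simp add: tensor_matrix_def Obj_D)

lemma kG_closed: "\<lbrakk> p \<in> carrier kG; s \<in> carrier G \<rbrakk> \<Longrightarrow> p s \<in> carrier k"
  by (auto simp: carrier_kG)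

lemma tensor_matrix_closed:
  assumes "a \<in> carrier A" and "p \<in> carrier kG"
  shows "tensor_matrix a p \<in> carrier C"
  using assms submoduleE(4)[OF gr_submodule] component_gr kG_closed
  by (auto simp: category_algebra_def Obj_D Hom_D tensor_matrix_def)

lemma tensor_matrix_bilinear: "bilinear k A kG C tensor_matrix"
proof -
  interpret kG: module k kG by (rule kG_module)
  interpret C: module k C by (rule C_module)
  note entry = linear_map.add[OF entry_linear] linear_map.smult[OF entry_linear]
    entry_tensor_matrix linear_map.add[OF component_linear] linear_map.smult[OF component_linear]
  show ?thesis
    unfolding bilinear_def
  proof (intro conjI ballI)
    fix a p assume a: "a \<in> carrier A" and p: "p \<in> carrier kG"
    show "tensor_matrix a p \<in> carrier C" using a p by (rule tensor_matrix_closed)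
    { fix b assume b: "b \<in> carrier A"
      show "tensor_matrix (a \<oplus>\<^bsub>A\<^esub> b) p = tensor_matrix a p \<oplus>\<^bsub>C\<^esub> tensor_matrix b p"
        using a b p
        by (intro C_ext) (simp_all add: tensor_matrix_closed entry smult_r_distr kG_closed component_closed) }
    { fix q assume q: "q \<in> carrier kG"
      have "(p \<oplus>\<^bsub>kG\<^esub> q) s = p s \<oplus>\<^bsub>k\<^esub> q s" if "s \<in> carrier G" for s
        using that by (simp add: function_algebra_def)
      then show "tensor_matrix a (p \<oplus>\<^bsub>kG\<^esub> q) = tensor_matrix a p \<oplus>\<^bsub>C\<^esub> tensor_matrix a q"
        using a p q
        by (intro C_ext) (simp_all add: tensor_matrix_closed entry smult_l_distr kG_closed component_closed) }
    { fix c assume c: "c \<in> carrier k"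
      show "tensor_matrix (c \<odot>\<^bsub>A\<^esub> a) p = c \<odot>\<^bsub>C\<^esub> tensor_matrix a p"
        using a c p
        by (intro C_ext)
          (simp_all add: tensor_matrix_closed entry smult_assoc1[symmetric] kG_closed
            component_closed R.m_comm)
      have "(c \<odot>\<^bsub>kG\<^esub> p) s = c \<otimes>\<^bsub>k\<^esub> p s" if "s \<in> carrier G" for s
        using that by (simp add: function_algebra_def)
      then show "tensor_matrix a (c \<odot>\<^bsub>kG\<^esub> p) = c \<odot>\<^bsub>C\<^esub> tensor_matrix a p"
        using a c p
        by (intro C_ext) (simp_all add: tensor_matrix_closed entry smult_assoc1 kG_closed component_closed) }
  qed
qed

lemma tensor_matrix_one: "tensor_matrix \<one>\<^bsub>A\<^esub> \<one>\<^bsub>kG\<^esub> = \<one>\<^bsub>C\<^esub>"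
proof -
  have one: "\<one>\<^bsub>kG\<^esub> s = \<one>\<^bsub>k\<^esub>" if "s \<in> carrier G" for s
    using that by (simp add: function_algebra_def)
  have "tensor_matrix \<one>\<^bsub>A\<^esub> \<one>\<^bsub>kG\<^esub> (((), t), ((), s)) = \<one>\<^bsub>C\<^esub> (((), t), ((), s))"
    if t: "t \<in> carrier G" and s: "s \<in> carrier G" for t s
  proof -
    \<comment> \<open>The unit of \<open>A\<close> has degree 1, so its component of degree t^-1 s
      vanishes off the diagonal.\<close>
    have "\<one>\<^bsub>G\<^esub> = inv\<^bsub>G\<^esub> t \<otimes>\<^bsub>G\<^esub> s \<longleftrightarrow> t = s"
      using s t by (metis inv_closed inv_equality inv_inv l_inv)
    then show ?thesis
      using s t gr_carrier[OF one_homogeneous]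
      by (simp add: entry_tensor_matrix one component_homogeneous[OF one_homogeneous]
          category_algebra_entry(3) Obj_D Hom_D)
        (simp add: smash_category_def single_object_category_def)
  qed
  moreover have "\<one>\<^bsub>kG\<^esub> \<in> carrier kG" by (simp add: function_algebra_def)
  moreover have "\<one>\<^bsub>C\<^esub> \<in> carrier C"
    using k_algebra.axioms(2)[OF C_k_algebra] by (simp add: ring.is_monoid monoid.one_closed)
  ultimately show ?thesis
    using gr_carrier[OF one_homogeneous] by (intro C_ext tensor_matrix_closed) auto
qed

text \<open>The computation that makes the matrix product obey the commutation rule. \<delta> at
  \<open>t\<close> leaves only column t^-1 of the first factor, so the middle index is r = t^-1. The
  second factor then contributes the component of \<open>f\<close> in degree \<open>t x\<close>,
  which vanishes unless s = t x. That condition says s^-1 t = x^-1, which is what \<delta> at s^-1 t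
  tests at x^-1.\<close>

lemma tensor_matrix_mult:
  assumes a: "a \<in> carrier A" and s: "s \<in> carrier G" and f: "f \<in> gr s"
    and t: "t \<in> carrier G" and u: "u \<in> carrier G"
  shows "tensor_matrix a (\<delta> t) \<otimes>\<^bsub>C\<^esub> tensor_matrix f (\<delta> u) =
    tensor_matrix (a \<otimes>\<^bsub>A\<^esub> f) (\<delta> (inv\<^bsub>G\<^esub> s \<otimes>\<^bsub>G\<^esub> t) \<otimes>\<^bsub>kG\<^esub> \<delta> u)"
proof (rule C_ext)
  have A_mult: "x \<otimes>\<^bsub>A\<^esub> y \<in> carrier A" if "x \<in> carrier A" "y \<in> carrier A" for x y
    using that k_algebra.axioms(2)[OF k_algebra_axioms]
    by (simp add: ring.is_monoid monoid.m_closed)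
  have fA: "f \<in> carrier A" using f s by (rule gr_carrier)
  have prod: "(p \<otimes>\<^bsub>kG\<^esub> q) x = p x \<otimes>\<^bsub>k\<^esub> q x" if "x \<in> carrier G" for p q x
    using that by (simp add: function_algebra_def)
  have prod_closed: "\<delta> x \<otimes>\<^bsub>kG\<^esub> \<delta> y \<in> carrier kG" for x y
    using kG_closed[OF dirac_kG] by (auto simp: function_algebra_def)
  show "tensor_matrix (a \<otimes>\<^bsub>A\<^esub> f) (\<delta> (inv\<^bsub>G\<^esub> s \<otimes>\<^bsub>G\<^esub> t) \<otimes>\<^bsub>kG\<^esub> \<delta> u) \<in> carrier C"
    using a fA by (intro tensor_matrix_closed A_mult prod_closed)
  have ma: "tensor_matrix a (\<delta> t) \<in> carrier C" and mf: "tensor_matrix f (\<delta> u) \<in> carrier C"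
    using a fA by (auto intro: tensor_matrix_closed dirac_kG)
  then show "tensor_matrix a (\<delta> t) \<otimes>\<^bsub>C\<^esub> tensor_matrix f (\<delta> u) \<in> carrier C"
    using k_algebra.axioms(2)[OF C_k_algebra] by (simp add: ring.is_monoid monoid.m_closed)
  fix z x assume z: "z \<in> carrier G" and x: "x \<in> carrier G"
  define summand where "summand r = (\<delta> t (inv\<^bsub>G\<^esub> r) \<odot>\<^bsub>A\<^esub> component (inv\<^bsub>G\<^esub> z \<otimes>\<^bsub>G\<^esub> r) a) \<otimes>\<^bsub>A\<^esub>
    (\<delta> u (inv\<^bsub>G\<^esub> x) \<odot>\<^bsub>A\<^esub> component (inv\<^bsub>G\<^esub> r \<otimes>\<^bsub>G\<^esub> x) f)" for r
  have summand_closed: "summand r \<in> carrier A" if "r \<in> carrier G" for r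
    unfolding summand_def using that z x a fA
    by (intro A_mult smult_closed kG_closed[OF dirac_kG] component_closed) auto
  have summand_zero: "summand r = \<zero>\<^bsub>A\<^esub>" if r: "r \<in> carrier G" and "inv\<^bsub>G\<^esub> t \<noteq> r" for r
  proof -
    have "inv\<^bsub>G\<^esub> r \<noteq> t" using that by auto
    then show ?thesis
      unfolding summand_def using r z x a fA
      by (simp add: dirac_def smult_mult_l component_closed)
  qed
  have "(tensor_matrix a (\<delta> t) \<otimes>\<^bsub>C\<^esub> tensor_matrix f (\<delta> u)) (((), z), ((), x)) =
      (\<Oplus>\<^bsub>A\<^esub> r \<in> carrier G. if inv\<^bsub>G\<^esub> t = r then summand r else \<zero>\<^bsub>A\<^esub>)"
    unfolding entry_mult[OF z x ma mf] using z x summand_closed summand_zero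
    by (intro M.finsum_cong') (auto simp: entry_tensor_matrix summand_def[symmetric])
  also have "\<dots> = summand (inv\<^bsub>G\<^esub> t)"
    using t summand_closed by (intro M.finsum_singleton finite_group) auto
  also have "\<dots> = component (inv\<^bsub>G\<^esub> z \<otimes>\<^bsub>G\<^esub> inv\<^bsub>G\<^esub> t) a \<otimes>\<^bsub>A\<^esub>
      (\<delta> u (inv\<^bsub>G\<^esub> x) \<odot>\<^bsub>A\<^esub> component (t \<otimes>\<^bsub>G\<^esub> x) f)"
    unfolding summand_def using t z a by (simp add: dirac_def component_closed)
  also have "\<dots> = (\<delta> (inv\<^bsub>G\<^esub> s \<otimes>\<^bsub>G\<^esub> t) (inv\<^bsub>G\<^esub> x) \<otimes>\<^bsub>k\<^esub> \<delta> u (inv\<^bsub>G\<^esub> x)) \<odot>\<^bsub>A\<^esub>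
      component (inv\<^bsub>G\<^esub> z \<otimes>\<^bsub>G\<^esub> x) (a \<otimes>\<^bsub>A\<^esub> f)"
  proof (cases "s = t \<otimes>\<^bsub>G\<^esub> x")
    case True
    have "t \<otimes>\<^bsub>G\<^esub> x \<otimes>\<^bsub>G\<^esub> inv\<^bsub>G\<^esub> x = t" using t x by (simp add: m_assoc)
    then have "inv\<^bsub>G\<^esub> s \<otimes>\<^bsub>G\<^esub> t = inv\<^bsub>G\<^esub> x"
      using True s t x by (metis inv_closed inv_solve_left)
    \<comment> \<open>This is the degree that \<open>component_mult\<close> yields for the product;
      it must match the degree z^-1 x of the entry at (z, x).\<close>
    moreover have "inv\<^bsub>G\<^esub> z \<otimes>\<^bsub>G\<^esub> inv\<^bsub>G\<^esub> t \<otimes>\<^bsub>G\<^esub> s = inv\<^bsub>G\<^esub> z \<otimes>\<^bsub>G\<^esub> x"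
      using True z t x by (simp add: m_assoc) (simp add: m_assoc[symmetric])
    ultimately show ?thesis
      using True component_mult[OF a f s, of "inv\<^bsub>G\<^esub> z \<otimes>\<^bsub>G\<^esub> inv\<^bsub>G\<^esub> t"] s t x z a f fA
        kG_closed[OF dirac_kG, of "inv\<^bsub>G\<^esub> x" u]
      by (simp add: component_homogeneous[OF f s] smult_mult_r component_closed)
        (simp add: dirac_def)
  next
    case False
    have "inv\<^bsub>G\<^esub> x \<noteq> inv\<^bsub>G\<^esub> s \<otimes>\<^bsub>G\<^esub> t"
    proof
      assume "inv\<^bsub>G\<^esub> x = inv\<^bsub>G\<^esub> s \<otimes>\<^bsub>G\<^esub> t"
      then have "s \<otimes>\<^bsub>G\<^esub> inv\<^bsub>G\<^esub> x = t" using s t x by (simp add: m_assoc[symmetric])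
      then show False using False s t x by (simp add: m_assoc flip: \<open>s \<otimes>\<^bsub>G\<^esub> inv\<^bsub>G\<^esub> x = t\<close>)
    qed
    then show ?thesis
      using False s t x z a f fA kG_closed[OF dirac_kG, of "inv\<^bsub>G\<^esub> x" u]
      by (simp add: component_homogeneous[OF f s])
        (simp add: dirac_def component_closed A_mult smult_mult_r)
  qed
  also have "\<dots> = tensor_matrix (a \<otimes>\<^bsub>A\<^esub> f) (\<delta> (inv\<^bsub>G\<^esub> s \<otimes>\<^bsub>G\<^esub> t) \<otimes>\<^bsub>kG\<^esub> \<delta> u) (((), z), ((), x))"
    using z x by (simp add: entry_tensor_matrix prod)
  finally show "(tensor_matrix a (\<delta> t) \<otimes>\<^bsub>C\<^esub> tensor_matrix f (\<delta> u)) (((), z), ((), x)) =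
      tensor_matrix (a \<otimes>\<^bsub>A\<^esub> f) (\<delta> (inv\<^bsub>G\<^esub> s \<otimes>\<^bsub>G\<^esub> t) \<otimes>\<^bsub>kG\<^esub> \<delta> u) (((), z), ((), x))" .
qed

section \<open>From matrices back to tensors\<close>

definition matrix_tensor :: "((unit \<times> 'g) \<times> (unit \<times> 'g) \<Rightarrow> 'a) \<Rightarrow> ('a \<times> ('g \<Rightarrow> 'k) \<Rightarrow> 'k) set"
  where "matrix_tensor m = (\<Oplus>\<^bsub>T\<^esub> s \<in> carrier G.
    tens (\<Oplus>\<^bsub>A\<^esub> t \<in> carrier G. m (((), t), ((), s))) (\<delta> (inv\<^bsub>G\<^esub> s)))"

lemma column_sum_linear:
  "s \<in> carrier G \<Longrightarrow> linear_map k C A (\<lambda>m. \<Oplus>\<^bsub>A\<^esub> t \<in> carrier G. m (((), t), ((), s)))"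
  by (intro linear_map_finsum C_module module_axioms entry_linear finite_group)

lemma column_summand_linear:
  assumes "s \<in> carrier G"
  shows "linear_map k C T (\<lambda>m. tens (\<Oplus>\<^bsub>A\<^esub> t \<in> carrier G. m (((), t), ((), s))) (\<delta> (inv\<^bsub>G\<^esub> s)))"
  by (rule linear_map_compose[OF column_sum_linear tens_linear_left[OF dirac_kG]]) fact

lemma matrix_tensor_linear: "linear_map k C T matrix_tensor"
  unfolding matrix_tensor_def[abs_def]
  by (intro linear_map_finsum C_module T_module column_summand_linear finite_group)

text \<open>\<open>t\<close> |-> t^-1 s permutes \<open>G\<close>, so reading down a column meets
  every degree exactly once.\<close>

lemma sum_component_column:
  assumes a: "a \<in> carrier A" and s: "s \<in> carrier G"
  shows "(\<Oplus>\<^bsub>A\<^esub> t \<in> carrier G. component (inv\<^bsub>G\<^esub> t \<otimes>\<^bsub>G\<^esub> s) a) = a"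
proof -
  let ?h = "\<lambda>t. inv\<^bsub>G\<^esub> t \<otimes>\<^bsub>G\<^esub> s"
  have "?h ` carrier G = carrier G"
  proof (intro equalityI subsetI)
    fix r assume r: "r \<in> carrier G"
    then show "r \<in> ?h ` carrier G"
      using s by (intro image_eqI[of _ _ "s \<otimes>\<^bsub>G\<^esub> inv\<^bsub>G\<^esub> r"]) (simp_all add: inv_mult_group m_assoc)
  qed (use s in auto)
  moreover have "inj_on ?h (carrier G)" using s by (auto intro!: inj_onI)
  ultimately have "(\<Oplus>\<^bsub>A\<^esub> t \<in> carrier G. component (?h t) a) = (\<Oplus>\<^bsub>A\<^esub> r \<in> carrier G. component r a)"
    using M.finsum_reindex[of "\<lambda>r. component r a" ?h "carrier G"] a component_closed by auto
  then show ?thesis using a by (simp add: sum_component)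
qed

text \<open>Only column u^-1 of this matrix can be nonzero, and it lists all components of
  \<open>a\<close>. Its sum is therefore \<open>a\<close>, and inverting the column index again
  gives back \<delta> at \<open>u\<close>.\<close>

lemma matrix_tensor_tensor_matrix:
  assumes a: "a \<in> carrier A" and u: "u \<in> carrier G"
  shows "matrix_tensor (tensor_matrix a (\<delta> u)) = tens a (\<delta> u)"
proof -
  interpret T: module k T by (rule T_module)
  have column: "tens (\<Oplus>\<^bsub>A\<^esub> t \<in> carrier G. tensor_matrix a (\<delta> u) (((), t), ((), s))) (\<delta> (inv\<^bsub>G\<^esub> s)) =
      (if inv\<^bsub>G\<^esub> u = s then tens a (\<delta> u) else \<zero>\<^bsub>T\<^esub>)" if s: "s \<in> carrier G" for s
  proof -
    have c: "\<delta> u (inv\<^bsub>G\<^esub> s) \<in> carrier k" using s by (intro kG_closed[OF dirac_kG]) simp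
    have "(\<Oplus>\<^bsub>A\<^esub> t \<in> carrier G. tensor_matrix a (\<delta> u) (((), t), ((), s))) =
        (\<Oplus>\<^bsub>A\<^esub> t \<in> carrier G. \<delta> u (inv\<^bsub>G\<^esub> s) \<odot>\<^bsub>A\<^esub> component (inv\<^bsub>G\<^esub> t \<otimes>\<^bsub>G\<^esub> s) a)"
      using s a c by (intro M.finsum_cong') (auto simp: entry_tensor_matrix component_closed)
    also have "\<dots> = \<delta> u (inv\<^bsub>G\<^esub> s) \<odot>\<^bsub>A\<^esub> (\<Oplus>\<^bsub>A\<^esub> t \<in> carrier G. component (inv\<^bsub>G\<^esub> t \<otimes>\<^bsub>G\<^esub> s) a)"
      using s a c component_closed by (intro finsum_smult_ldistr[symmetric] finite_group) auto
    also have "\<dots> = \<delta> u (inv\<^bsub>G\<^esub> s) \<odot>\<^bsub>A\<^esub> a" using a s by (simp add: sum_component_column)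
    finally have sum: "(\<Oplus>\<^bsub>A\<^esub> t \<in> carrier G. tensor_matrix a (\<delta> u) (((), t), ((), s))) =
        \<delta> u (inv\<^bsub>G\<^esub> s) \<odot>\<^bsub>A\<^esub> a" .
    show ?thesis
    proof (cases "inv\<^bsub>G\<^esub> u = s")
      case True
      then have "inv\<^bsub>G\<^esub> s = u" using u by auto
      with True show ?thesis using a u by (simp add: sum) (simp add: dirac_def)
    next
      case False
      then have "inv\<^bsub>G\<^esub> s \<noteq> u" using s by auto
      with False s have "\<delta> u (inv\<^bsub>G\<^esub> s) \<odot>\<^bsub>A\<^esub> a = \<zero>\<^bsub>A\<^esub>" using a by (simp add: dirac_def)
      with False show ?thesis by (simp add: sum linear_map.zero[OF tens_linear_left[OF dirac_kG]])
    qed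
  qed
  have "matrix_tensor (tensor_matrix a (\<delta> u)) =
      (\<Oplus>\<^bsub>T\<^esub> s \<in> carrier G. if inv\<^bsub>G\<^esub> u = s then tens a (\<delta> u) else \<zero>\<^bsub>T\<^esub>)"
    unfolding matrix_tensor_def
    using a column by (intro T.M.finsum_cong') (auto simp: tens_closed dirac_kG)
  also have "\<dots> = tens a (\<delta> u)"
    using a u by (intro T.M.finsum_singleton finite_group) (auto simp: tens_closed dirac_kG)
  finally show ?thesis .
qed

text \<open>The entries of a column are homogeneous of pairwise distinct degrees that exhaust
  \<open>G\<close>. The column is thus already the decomposition of its sum, and uniqueness recovers
  each entry.\<close>

lemma component_column_sum:
  assumes m: "m \<in> carrier C" and t: "t \<in> carrier G" and s: "s \<in> carrier G"
  shows "component (inv\<^bsub>G\<^esub> t \<otimes>\<^bsub>G\<^esub> s) (\<Oplus>\<^bsub>A\<^esub> r \<in> carrier G. m (((), r), ((), s))) = m (((), t), ((), s))"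
proof -
  \<comment> \<open>The row s r^-1 is where column \<open>s\<close> carries degree \<open>r\<close>:
    it solves t^-1 s = r for \<open>t\<close>.\<close>
  define c where "c r = m (((), s \<otimes>\<^bsub>G\<^esub> inv\<^bsub>G\<^esub> r), ((), s))" for r
  have cancel: "s \<otimes>\<^bsub>G\<^esub> inv\<^bsub>G\<^esub> (inv\<^bsub>G\<^esub> r \<otimes>\<^bsub>G\<^esub> s) = r" "inv\<^bsub>G\<^esub> (s \<otimes>\<^bsub>G\<^esub> inv\<^bsub>G\<^esub> r) \<otimes>\<^bsub>G\<^esub> s = r"
    "s \<otimes>\<^bsub>G\<^esub> inv\<^bsub>G\<^esub> (s \<otimes>\<^bsub>G\<^esub> inv\<^bsub>G\<^esub> r) = s \<otimes>\<^bsub>G\<^esub> (r \<otimes>\<^bsub>G\<^esub> inv\<^bsub>G\<^esub> s)"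
    if "r \<in> carrier G" for r
    using that s by (simp_all add: inv_mult_group m_assoc) (simp_all add: m_assoc[symmetric])
  have c: "c r \<in> gr r" if "r \<in> carrier G" for r
    using entry_gr[of "s \<otimes>\<^bsub>G\<^esub> inv\<^bsub>G\<^esub> r" s m] that s m by (simp add: c_def cancel)
  have cA: "c \<in> carrier G \<rightarrow> carrier A" using c gr_carrier by blast
  let ?h = "\<lambda>t. inv\<^bsub>G\<^esub> t \<otimes>\<^bsub>G\<^esub> s"
  have image: "?h ` carrier G = carrier G"
  proof (intro equalityI subsetI)
    fix r assume r: "r \<in> carrier G"
    then show "r \<in> ?h ` carrier G"
      using s by (intro image_eqI[of _ _ "s \<otimes>\<^bsub>G\<^esub> inv\<^bsub>G\<^esub> r"]) (simp_all add: cancel)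
  qed (use s in auto)
  have inj: "inj_on ?h (carrier G)" using s by (auto intro!: inj_onI)
  have "(\<Oplus>\<^bsub>A\<^esub> r \<in> carrier G. m (((), r), ((), s))) = (\<Oplus>\<^bsub>A\<^esub> r \<in> carrier G. c (?h r))"
    using s linear_map.closed[OF entry_linear] m
    by (intro M.finsum_cong') (auto simp: c_def cancel)
  also have "\<dots> = (\<Oplus>\<^bsub>A\<^esub> r \<in> carrier G. c r)"
    using M.finsum_reindex[of c ?h "carrier G"] inj cA by (simp add: image)
  finally have "component (?h t) (\<Oplus>\<^bsub>A\<^esub> r \<in> carrier G. m (((), r), ((), s))) = c (?h t)"
    using c s t by (intro component_eqI) auto
  then show ?thesis using t by (simp add: c_def cancel)
qed

text \<open>The map \<psi> is the one given by the universal property for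
  \<open>tensor_matrix\<close>. The composite on \<open>T\<close> is compared with the identity on
  spanning tensors, the composite on matrices entry by entry.\<close>

lemma ex_tensor_matrix_inverse:
  "\<exists>\<psi>. linear_map k T C \<psi> \<and>
    (\<forall>a \<in> carrier A. \<forall>p \<in> carrier kG. \<psi> (tens a p) = tensor_matrix a p) \<and>
    (\<forall>X \<in> carrier T. matrix_tensor (\<psi> X) = X) \<and> (\<forall>m \<in> carrier C. \<psi> (matrix_tensor m) = m)"
proof -
  obtain \<psi> where \<psi>: "linear_map k T C \<psi>"
    and \<psi>_tens: "\<And>a p. \<lbrakk> a \<in> carrier A; p \<in> carrier kG \<rbrakk> \<Longrightarrow> \<psi> (tens a p) = tensor_matrix a p"
    using tensor_product_lift[OF module_axioms kG_module C_module tensor_matrix_bilinear] by blast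
  interpret \<psi>: linear_map k T C \<psi> by fact
  interpret \<eta>: linear_map k C T matrix_tensor by (rule matrix_tensor_linear)
  have "carrier T \<subseteq> {X \<in> carrier T. matrix_tensor (\<psi> X) = X}"
    by (rule T_spanned_dirac,
        rule equalizer_submodule[OF linear_map_compose[OF \<psi> matrix_tensor_linear]
          linear_map_id[OF T_module]])
      (simp add: tens_closed \<psi>_tens dirac_kG matrix_tensor_tensor_matrix)
  moreover have "\<psi> (matrix_tensor m) = m" if m: "m \<in> carrier C" for m
  proof (rule C_ext)
    fix t s assume t: "t \<in> carrier G" and s: "s \<in> carrier G"
    define a where "a r = (\<Oplus>\<^bsub>A\<^esub> t \<in> carrier G. m (((), t), ((), r)))" for r
    have a: "a r \<in> carrier A" if "r \<in> carrier G" for r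
      unfolding a_def using that m by (rule linear_map.closed[OF column_sum_linear])
    have "\<psi> (matrix_tensor m) (((), t), ((), s)) =
        (\<Oplus>\<^bsub>A\<^esub> r \<in> carrier G. \<psi> (tens (a r) (\<delta> (inv\<^bsub>G\<^esub> r))) (((), t), ((), s)))"
      unfolding matrix_tensor_def a_def[symmetric] using a
      by (intro linear_map.finsum[OF linear_map_compose[OF \<psi> entry_linear[OF t s]]])
        (auto simp: tens_closed dirac_kG)
    \<comment> \<open>Only r = s reaches column \<open>s\<close>, because \<delta> at r^-1 vanishes
      at s^-1 otherwise; in the surviving term \<open>component_column_sum\<close> restores the
      entry.\<close>
    also have "\<dots> = (\<Oplus>\<^bsub>A\<^esub> r \<in> carrier G. if s = r then m (((), t), ((), s)) else \<zero>\<^bsub>A\<^esub>)"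
    proof (rule M.finsum_cong')
      fix r assume r: "r \<in> carrier G"
      have "\<delta> (inv\<^bsub>G\<^esub> r) (inv\<^bsub>G\<^esub> s) = (if s = r then \<one>\<^bsub>k\<^esub> else \<zero>\<^bsub>k\<^esub>)"
        using r s by (auto simp: dirac_def)
      then show "\<psi> (tens (a r) (\<delta> (inv\<^bsub>G\<^esub> r))) (((), t), ((), s)) =
          (if s = r then m (((), t), ((), s)) else \<zero>\<^bsub>A\<^esub>)"
        using r s t a[OF r] component_column_sum[OF m t s]
        by (auto simp: \<psi>_tens dirac_kG entry_tensor_matrix component_closed a_def
            linear_map.closed[OF entry_linear] m)
    qed (use s t m linear_map.closed[OF entry_linear] in auto)
    also have "\<dots> = m (((), t), ((), s))"
      using s t m linear_map.closed[OF entry_linear] by (intro M.finsum_singleton finite_group) auto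
    finally show "\<psi> (matrix_tensor m) (((), t), ((), s)) = m (((), t), ((), s))" .
  qed (use m in \<open>auto intro: \<psi>.closed \<eta>.closed\<close>)
  ultimately show ?thesis using \<psi> \<psi>_tens by blast
qed

text \<open>Linear extension in two stages. With left argument a tensor of \<open>a\<close> and
  \<delta> at \<open>t\<close>, the commutation rule fixes the values on homogeneous tensors, hence
  on all of \<open>T\<close>. With any right argument fixed, both products then agree on spanning
  left arguments, hence everywhere on \<open>T\<close>. Off the carrier both are
  \<open>undefined\<close>.\<close>

lemma is_smash_product_mult_unique:
  assumes \<mu>: "is_smash_product_mult k G A gr \<mu>" and \<nu>: "is_smash_product_mult k G A gr \<nu>"
  shows "\<mu> = \<nu>"
proof (intro ext)
  fix X Y
  have bilin: "bilinear k T T T \<mu>" "bilinear k T T T \<nu>"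
    using assms by (simp_all add: is_smash_product_mult_def Let_def)
  note left = bilinear_linear_left[OF T_module T_module bilin(1)]
    bilinear_linear_left[OF T_module T_module bilin(2)]
  note right = bilinear_linear_right[OF T_module T_module bilin(1)]
    bilinear_linear_right[OF T_module T_module bilin(2)]
  have gen: "\<mu> (tens a (\<delta> t)) (tens f (\<delta> u)) = \<nu> (tens a (\<delta> t)) (tens f (\<delta> u))"
    if "a \<in> carrier A" "s \<in> carrier G" "f \<in> gr s" "t \<in> carrier G" "u \<in> carrier G" for a s f t u
    using assms that by (simp add: is_smash_product_mult_def Let_def)
  have dirac_left: "carrier T \<subseteq> {Y \<in> carrier T. \<mu> (tens a (\<delta> t)) Y = \<nu> (tens a (\<delta> t)) Y}"
    if a: "a \<in> carrier A" and t: "t \<in> carrier G" for a t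
  proof (rule T_spanned, rule equalizer_submodule)
    have "tens a (\<delta> t) \<in> carrier T" using a by (simp add: tens_closed dirac_kG)
    then show "linear_map k T T (\<mu> (tens a (\<delta> t)))" "linear_map k T T (\<nu> (tens a (\<delta> t)))"
      by (rule right)+
  qed (use a t gen in \<open>auto intro: tens_closed dirac_kG gr_carrier\<close>)
  have "\<mu> X Y = \<nu> X Y" if X: "X \<in> carrier T" and Y: "Y \<in> carrier T" for X Y
  proof -
    have "carrier T \<subseteq> {X \<in> carrier T. \<mu> X Y = \<nu> X Y}"
      by (rule T_spanned_dirac, rule equalizer_submodule[OF left[OF Y]])
        (use dirac_left Y in \<open>auto simp: tens_closed dirac_kG\<close>)
    then show ?thesis using X by blast
  qed
  moreover have "\<mu> X Y = undefined \<and> \<nu> X Y = undefined" if "X \<notin> carrier T \<or> Y \<notin> carrier T"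
    using assms that by (simp add: is_smash_product_mult_def Let_def)
  ultimately show "\<mu> X Y = \<nu> X Y" by metis
qed

lemma smash_algebra_iso:
  shows "k_algebra k (smash_algebra k G A gr)"
    and "matrix_tensor \<in> k_algebra_iso k C (smash_algebra k G A gr)"
proof -
  interpret C: k_algebra k C by (rule C_k_algebra)
  interpret T: module k T by (rule T_module)
  have C_ring: "ring C" by (rule k_algebra.axioms(2)[OF C_k_algebra])
  have C_mult: "f \<otimes>\<^bsub>C\<^esub> g \<in> carrier C" if "f \<in> carrier C" "g \<in> carrier C" for f g
    using that C_ring by (simp add: ring.is_monoid monoid.m_closed)
  interpret \<eta>: linear_map k C T matrix_tensor by (rule matrix_tensor_linear)
  from ex_tensor_matrix_inverse obtain \<psi> where \<psi>: "linear_map k T C \<psi>"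
      "\<forall>a \<in> carrier A. \<forall>p \<in> carrier kG. \<psi> (tens a p) = tensor_matrix a p"
      "\<forall>X \<in> carrier T. matrix_tensor (\<psi> X) = X" "\<forall>m \<in> carrier C. \<psi> (matrix_tensor m) = m"
    by (elim exE conjE)
  note \<psi>_tens = \<psi>(2)[rule_format] and \<eta>\<psi> = \<psi>(3)[rule_format] and \<psi>\<eta> = \<psi>(4)[rule_format]
  interpret \<psi>: linear_map k T C \<psi> by (rule \<psi>(1))
  \<comment> \<open>The matrix product carried to the tensor product; \<open>undefined\<close> off
    the carrier is the value that \<open>is_smash_product_mult\<close> prescribes.\<close>
  define \<mu> where "\<mu> X Y =
    (if X \<in> carrier T \<and> Y \<in> carrier T then matrix_tensor (\<psi> X \<otimes>\<^bsub>C\<^esub> \<psi> Y) else undefined)" for X Y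
  have "is_smash_product_mult k G A gr \<mu>"
    unfolding is_smash_product_mult_def Let_def
  proof (intro conjI ballI)
    show "bilinear k T T T \<mu>"
      unfolding bilinear_def
      by (simp add: \<mu>_def \<eta>.closed \<psi>.closed C_mult \<psi>.add \<psi>.smult C.l_distr C.r_distr
          C.smult_mult_l C.smult_mult_r \<eta>.add \<eta>.smult)
    fix a s f t u
    assume a: "a \<in> carrier A" and s: "s \<in> carrier G" and f: "f \<in> gr s"
      and t: "t \<in> carrier G" and u: "u \<in> carrier G"
    have fA: "f \<in> carrier A" using f s by (rule gr_carrier)
    have af: "a \<otimes>\<^bsub>A\<^esub> f \<in> carrier A"
      using a fA k_algebra.axioms(2)[OF k_algebra_axioms] by (simp add: ring.is_monoid monoid.m_closed)
    have p: "\<delta> (inv\<^bsub>G\<^esub> s \<otimes>\<^bsub>G\<^esub> t) \<otimes>\<^bsub>kG\<^esub> \<delta> u \<in> carrier kG"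
      using kG_closed[OF dirac_kG] by (auto simp: function_algebra_def)
    \<comment> \<open>\<psi> turns both tensors into matrices, \<open>tensor_matrix_mult\<close>
      computes their product as the matrix of the right-hand tensor, and
      \<open>matrix_tensor\<close> undoes \<psi>.\<close>
    show "\<mu> (tens a (\<delta> t)) (tens f (\<delta> u)) =
        tens (a \<otimes>\<^bsub>A\<^esub> f) (\<delta> (inv\<^bsub>G\<^esub> s \<otimes>\<^bsub>G\<^esub> t) \<otimes>\<^bsub>kG\<^esub> \<delta> u)"
      using \<eta>\<psi>[OF tens_closed[OF af p]] a fA
      by (simp add: \<mu>_def tens_closed dirac_kG \<psi>_tens af p tensor_matrix_mult[OF a s f t u])
  qed (auto simp: \<mu>_def)
  then have the: "(THE \<mu>. is_smash_product_mult k G A gr \<mu>) = \<mu>"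
    using is_smash_product_mult_unique by (intro the_equality)
  let ?S = "smash_algebra k G A gr"
  have S: "?S = T\<lparr>mult := \<mu>, one := tens \<one>\<^bsub>A\<^esub> \<one>\<^bsub>kG\<^esub>\<rparr>"
    by (simp add: smash_algebra_def Let_def the)
  interpret S: module k ?S unfolding S by (rule module_mult_one_update) (rule T_module)
  have lin: "linear_map k C ?S matrix_tensor"
    by unfold_locales (simp_all add: S \<eta>.closed \<eta>.add \<eta>.smult)
  have bij: "bij_betw matrix_tensor (carrier C) (carrier ?S)"
    by (rule bij_betw_byWitness[where f' = \<psi>])
      (auto simp: S \<eta>.closed \<psi>.closed \<eta>\<psi> \<psi>\<eta>)
  have mult: "matrix_tensor (f \<otimes>\<^bsub>C\<^esub> g) = matrix_tensor f \<otimes>\<^bsub>?S\<^esub> matrix_tensor g"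
    if "f \<in> carrier C" "g \<in> carrier C" for f g
    using that by (simp add: S \<mu>_def \<eta>.closed \<psi>\<eta>)
  have "\<one>\<^bsub>A\<^esub> \<in> carrier A" "\<one>\<^bsub>kG\<^esub> \<in> carrier kG"
    using gr_carrier[OF one_homogeneous] by (auto simp: function_algebra_def)
  then have one: "matrix_tensor \<one>\<^bsub>C\<^esub> = \<one>\<^bsub>?S\<^esub>"
    using \<eta>\<psi>[OF tens_closed, of "\<one>\<^bsub>A\<^esub>" "\<one>\<^bsub>kG\<^esub>"] by (simp add: S \<psi>_tens tensor_matrix_one)
  show "k_algebra k ?S" "matrix_tensor \<in> k_algebra_iso k C ?S"
    by (rule k_algebra_transport[OF C_k_algebra lin bij], rule mult, assumption+, rule one)+
qed

end

theorem proposition3p7: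
  fixes k :: "('k, 'r) ring_scheme"
    and G :: "('g, 's) monoid_scheme"
    and A :: "('k, 'a) module"
    and gr :: "'g \<Rightarrow> 'a set"
  assumes "cring k"
    and "group G" and "finite (carrier G)"
    and "graded_algebra k G A gr"
  shows "graded_category k G (single_object_category A) (\<lambda>_ _. gr) \<and>
    k_algebra k (category_algebra (smash_category G (single_object_category A) (\<lambda>_ _. gr))) \<and>
    k_algebra k (smash_algebra k G A gr) \<and>
    (\<exists>h. h \<in> k_algebra_iso k
      (category_algebra (smash_category G (single_object_category A) (\<lambda>_ _. gr)))
      (smash_algebra k G A gr))"
proof -
  interpret finite_graded_algebra k G A gr
    using assms by (simp add: finite_graded_algebra_def finite_graded_algebra_axioms_def)
  show ?thesis
    using single_object_graded_category[OF assms(4)] C_k_algebra smash_algebra_iso by blast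
qed

end
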